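(* Let $N\ge 2$ be an integer, $0<\beta\le 1$, and let $\lambda, \eta, P_s, P_r, d_{sr}, \sigma_{i1}^2, \sigma_{i2}^2$ be positive reals. Let $R_e>0$ and $\tau_e=2^{R_e}-1$. In the relay wiretap channel model described in the context, the secrecy outage probability $P_{so}=\Pr(\Gamma_E>\tau_e)$ is $$P_{so}=1-\exp\left(-2\lambda\left(\mathcal{J}_1+\mathcal{J}_2-\mathcal{J}_3\right)\right),$$ where $$\mathcal{J}_{1}=\frac{\pi}{\eta}\left(\frac{\beta P_s}{\tau_e\sigma_{i1}^2}\right)^{\frac{2}{\eta}}\left(1+\frac{(1-\beta)\tau_e}{\beta(N-1)}\right)^{-(N-1)}\Gamma\left(\frac{2}{\eta}\right),$$ $$\mathcal{J}_{2}=\int_{0}^{\infty}\int_{0}^{\pi} r\,\exp\left(-\psi(r,\theta)\right)\,d\theta\,dr,$$ $$\mathcal{J}_{3}=\left(1+\frac{(1-\beta)\tau_e}{\beta(N-1)}\right)^{-(N-1)}\int_{0}^{\infty}\int_{0}^{\pi} r\,\exp\left(-\frac{\tau_e\sigma_{i1}^2}{\beta P_s}r^{\eta}\right)\exp\left(-\psi(r,\theta)\right)\,d\theta\,dr,$$ and $$\psi(r,\theta)=\frac{\tau_e\sigma_{i2}^2}{P_r}\left(d_{sr}^2+r^2-2d_{sr}r\cos\theta\right)^{\frac{\eta}{2}}.$$ Here $\Gamma(\cdot)$ with a numerical argument is the Euler gamma function.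
   Context: Geometry: the source is at the origin of $\mathbb{R}^2$ and the relay is at a fixed point at distance $d_{sr}$ from the source. The eavesdropper locations form a homogeneous Poisson point process $\Phi$ on $\mathbb{R}^2$ with density $\lambda$ (the source and the relay do not belong to $\Phi$). For $i\in\Phi$, $d_{si}$ and $d_{ri}$ denote the Euclidean distances from $i$ to the source and to the relay. The path loss exponent is $\eta$; $P_s$ and $P_r$ are the transmit powers at the source and relay. Fading: the source has $N$ antennas; the relay and each eavesdropper have one. $\mathbf{h}_{sr}$ (source to relay, a $1\times N$ row vector), and for each $i\in\Phi$, $\mathbf{h}_{si}$ (source to eavesdropper $i$, a $1\times N$ row vector) and $h_{ri}$ (relay to eavesdropper $i$, a scalar), are Rayleigh: all their entries are i.i.d. $\mathcal{CN}(0,1)$ (circularly symmetric complex Gaussian, so squared modulus is exponential with mean $1$). All these channels are mutually independent, independent across $i\in\Phi$, and independent of $\Phi$. Beamforming: $\mathbf{W}=[\mathbf{w}_{\text{S}}\ \ \mathbf{W}_{\text{AN}}]$ is the $N\times N$ unitary matrix, determined by $\mathbf{h}_{sr}$, where $\mathbf{w}_{\text{S}}$ is a unit eigenvector for the largest eigenvalue of $\mathbf{h}_{sr}^H\mathbf{h}_{sr}$ and the columns of $\mathbf{W}_{\text{AN}}$ are the remaining $N-1$ orthonormal eigenvectors. $\beta$ is the fraction of source power allocated to the information signal; the remaining fraction $1-\beta$ is spread equally over the $N-1$ artificial noise directions. Eavesdropper SNRs: the noise variances at the eavesdroppers in the two time slots are $\sigma_{i1}^2$ and $\sigma_{i2}^2$,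 the same for all eavesdroppers. For $i\in\Phi$, $$\gamma_{si}=\frac{\beta P_s d_{si}^{-\eta}|\mathbf{h}_{si}\mathbf{w}_{\text{S}}|^2}{\frac{1-\beta}{N-1}P_s d_{si}^{-\eta}\,\mathbf{h}_{si}\mathbf{W}_{\text{AN}}\mathbf{W}_{\text{AN}}^H\mathbf{h}_{si}^H+\sigma_{i1}^2},\qquad \gamma_{ri}=\frac{P_r}{d_{ri}^{\eta}\sigma_{i2}^2}|h_{ri}|^2,$$ and (non-colluding eavesdroppers) $$\Gamma_E=\max_{i\in\Phi}\left\{\max\{\gamma_{si},\gamma_{ri}\}\right\}.$$ Thus the event $\{\Gamma_E>\tau_e\}$ is the event that $\max\{\gamma_{si},\gamma_{ri}\}>\tau_e$ for some $i\in\Phi$. *)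

theory Defs
  imports "HOL-Probability.Probability"
begin

text \<open>The library's \<open>indep_var\<close> needs both variables to take values in the same type.\<close>
definition indep_elements ::
  "'w measure \<Rightarrow> 'a measure \<Rightarrow> ('w \<Rightarrow> 'a) \<Rightarrow> 'b measure \<Rightarrow> ('w \<Rightarrow> 'b) \<Rightarrow> bool" where
  "indep_elements M S X T Y \<longleftrightarrow>
     X \<in> measurable M S \<and> Y \<in> measurable M T \<and>
     prob_space.indep_set M {X -` A \<inter> space M |A. A \<in> sets S} {Y -` B \<inter> space M |B. B \<in> sets T}"

text \<open>\<open>CN(0,1)\<close>: real and imaginary parts are independent real Gaussians of variance \<open>1/2\<close>.\<close>
definition std_complex_gaussian :: "'w measure \<Rightarrow> ('w \<Rightarrow> complex) \<Rightarrow> bool" where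
  "std_complex_gaussian M Z \<longleftrightarrow>
     distributed M lborel Z (\<lambda>z. ennreal (exp (- (cmod z)\<^sup>2) / pi))"

text \<open>Homogeneous Poisson point process of density \<open>lam\<close>, as a locally finite random set.
  The Poisson probabilities are written out because \<open>poisson_pmf\<close> requires a positive rate,
  while \<open>B\<close> may be a null set.\<close>
definition homogeneous_ppp ::
  "'w measure \<Rightarrow> real \<Rightarrow> ('w \<Rightarrow> 'a::euclidean_space set) \<Rightarrow> bool" where
  "homogeneous_ppp M lam \<Phi> \<longleftrightarrow>
     (AE \<omega> in M. \<forall>B. bounded B \<longrightarrow> finite (\<Phi> \<omega> \<inter> B)) \<and>
     (\<forall>B. B \<in> sets borel \<and> bounded B \<longrightarrow>
        (\<lambda>\<omega>. card (\<Phi> \<omega> \<inter> B)) \<in> measurable M (count_space UNIV) \<and>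
        (\<forall>k. measure M {\<omega> \<in> space M. card (\<Phi> \<omega> \<inter> B) = k}
             = (lam * measure lborel B) ^ k / fact k * exp (- (lam * measure lborel B)))) \<and>
     (\<forall>(I :: nat set) B. finite I \<and> disjoint_family_on B I \<and>
        (\<forall>i\<in>I. B i \<in> sets borel \<and> bounded (B i)) \<longrightarrow>
        prob_space.indep_vars M (\<lambda>_. count_space UNIV) (\<lambda>i \<omega>. card (\<Phi> \<omega> \<inter> B i)) I)"

text \<open>\<open>SR k\<close>: source antenna \<open>k\<close> to relay; \<open>SE i k\<close>: source antenna \<open>k\<close> to eavesdropper \<open>i\<close>;
  \<open>RE i\<close>: relay to eavesdropper \<open>i\<close>.\<close>
datatype 'n channel = SR 'n | SE nat 'n | RE nat

primrec channel_coeff ::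
  "('w \<Rightarrow> complex ^ 'n) \<Rightarrow> (nat \<Rightarrow> 'w \<Rightarrow> complex ^ 'n) \<Rightarrow> (nat \<Rightarrow> 'w \<Rightarrow> complex) \<Rightarrow>
   'n channel \<Rightarrow> 'w \<Rightarrow> complex" where
  "channel_coeff hsr hs hr (SR k) = (\<lambda>\<omega>. hsr \<omega> $ k)"
| "channel_coeff hsr hs hr (SE i k) = (\<lambda>\<omega>. hs i \<omega> $ k)"
| "channel_coeff hsr hs hr (RE i) = hr i"

definition ctranspose :: "complex ^ 'n ^ 'm \<Rightarrow> complex ^ 'm ^ 'n" where
  "ctranspose A = transpose (map_matrix cnj A)"

definition unitary_matrix :: "complex ^ 'm ^ 'n \<Rightarrow> bool" where
  "unitary_matrix A \<longleftrightarrow> ctranspose A ** A = mat 1 \<and> A ** ctranspose A = mat 1"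

definition eigenpair :: "complex ^ 'n ^ 'n \<Rightarrow> complex \<Rightarrow> complex ^ 'n \<Rightarrow> bool" where
  "eigenpair A c v \<longleftrightarrow> v \<noteq> 0 \<and> A *v v = c *s v"

text \<open>Meant for Hermitian matrices, whose eigenvalues are real.\<close>
definition largest_eigenvalue :: "complex ^ 'n ^ 'n \<Rightarrow> real \<Rightarrow> bool" where
  "largest_eigenvalue A \<mu> \<longleftrightarrow>
     (\<exists>v. eigenpair A (of_real \<mu>) v) \<and> (\<forall>\<nu> v. eigenpair A (of_real \<nu>) v \<longrightarrow> \<nu> \<le> \<mu>)"

text \<open>\<open>h\<^sup>H h\<close> for a row vector \<open>h\<close>.\<close>
definition gram :: "complex ^ 'n \<Rightarrow> complex ^ 'n ^ 'n" where
  "gram h = ctranspose (rowvector h :: complex ^ 'n ^ 1) ** (rowvector h :: complex ^ 'n ^ 1)"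

text \<open>The block matrix \<open>[w A]\<close>; the column index \<open>None\<close> is that of \<open>w\<close>.\<close>
definition beam_matrix :: "complex ^ 'n \<Rightarrow> complex ^ 'm ^ 'n \<Rightarrow> complex ^ 'm option ^ 'n" where
  "beam_matrix w A = (\<chi> i j. case j of None \<Rightarrow> w $ i | Some k \<Rightarrow> A $ i $ k)"

definition beamforming :: "complex ^ 'n \<Rightarrow> complex ^ 'n \<Rightarrow> complex ^ 'm ^ 'n \<Rightarrow> bool" where
  "beamforming h w A \<longleftrightarrow>
     unitary_matrix (beam_matrix w A) \<and>
     (\<exists>\<mu>. largest_eigenvalue (gram h) \<mu> \<and> eigenpair (gram h) (of_real \<mu>) w) \<and>
     (\<forall>k. \<exists>\<nu>. eigenpair (gram h) \<nu> (column k A))"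

text \<open>\<open>d\<close> is the distance to the transmitter; row vector times column vector is the bilinear
  \<open>scalar_product\<close> (no conjugation). \<open>v1\<close>, \<open>v2\<close> are the noise variances.\<close>

text \<open>\<open>h A A\<^sup>H h\<^sup>H\<close>, which is real.\<close>
definition an_power :: "complex ^ 'm ^ 'n \<Rightarrow> complex ^ 'n \<Rightarrow> real" where
  "an_power A h = Re (scalar_product (h v* A v* ctranspose A) (\<chi> k. cnj (h $ k)))"

definition snr_source ::
  "real \<Rightarrow> real \<Rightarrow> real \<Rightarrow> real \<Rightarrow> complex ^ 'n \<Rightarrow> complex ^ 'm ^ 'n \<Rightarrow> real \<Rightarrow> complex ^ 'n \<Rightarrow> real" where
  "snr_source \<beta> Ps \<eta> v1 w A d h =
     (\<beta> * Ps * d powr (- \<eta>) * (cmod (scalar_product h w))\<^sup>2) /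
     ((1 - \<beta>) / (real CARD('n) - 1) * Ps * d powr (- \<eta>) * an_power A h + v1)"

definition snr_relay :: "real \<Rightarrow> real \<Rightarrow> real \<Rightarrow> real \<Rightarrow> complex \<Rightarrow> real" where
  "snr_relay Pr \<eta> v2 d h = Pr / (d powr \<eta> * v2) * (cmod h)\<^sup>2"

definition psi :: "real \<Rightarrow> real \<Rightarrow> real \<Rightarrow> real \<Rightarrow> real \<Rightarrow> real \<Rightarrow> real \<Rightarrow> real" where
  "psi \<eta> Pr dsr v2 \<tau> r \<theta> =
     \<tau> * v2 / Pr * (dsr\<^sup>2 + r\<^sup>2 - 2 * dsr * r * cos \<theta>) powr (\<eta> / 2)"

definition an_factor :: "nat \<Rightarrow> real \<Rightarrow> real \<Rightarrow> real" where
  "an_factor N \<beta> \<tau> = (1 + (1 - \<beta>) * \<tau> / (\<beta> * (real N - 1))) powr (- (real N - 1))"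

definition J1 :: "nat \<Rightarrow> real \<Rightarrow> real \<Rightarrow> real \<Rightarrow> real \<Rightarrow> real \<Rightarrow> real" where
  "J1 N \<beta> \<eta> Ps v1 \<tau> =
     pi / \<eta> * (\<beta> * Ps / (\<tau> * v1)) powr (2 / \<eta>) * an_factor N \<beta> \<tau> * Gamma (2 / \<eta>)"

definition J2 :: "real \<Rightarrow> real \<Rightarrow> real \<Rightarrow> real \<Rightarrow> real \<Rightarrow> real" where
  "J2 \<eta> Pr dsr v2 \<tau> =
     (LBINT r=0..\<infinity>. (LBINT \<theta>=0..ereal pi. r * exp (- psi \<eta> Pr dsr v2 \<tau> r \<theta>)))"

definition J3 ::
  "nat \<Rightarrow> real \<Rightarrow> real \<Rightarrow> real \<Rightarrow> real \<Rightarrow> real \<Rightarrow> real \<Rightarrow> real \<Rightarrow> real \<Rightarrow> real" where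
  "J3 N \<beta> \<eta> Ps Pr dsr v1 v2 \<tau> =
     an_factor N \<beta> \<tau> *
     (LBINT r=0..\<infinity>. (LBINT \<theta>=0..ereal pi.
        r * exp (- (\<tau> * v1 / (\<beta> * Ps) * r powr \<eta>)) * exp (- psi \<eta> Pr dsr v2 \<tau> r \<theta>)))"

end

theory Submission
  imports Defs
begin

text \<open>
  Given the point process, the outage indicators of distinct eavesdroppers become independent once
  \<open>hsr\<close> is fixed, and their laws do not depend on \<open>hsr\<close>: the beamforming matrix is unitary and
  the standard complex Gaussian vector is invariant under linear isometries, so
  \<open>hs i v* [wS WAN]\<close> is again standard Gaussian and the outage probability at a location is an
  exponential tail averaged over \<open>N - 1\<close> exponential variables. The probability that nobody is
  in outage is therefore \<open>E (\<Prod>i. 1 - p (X i))\<close>, which the probability generating functional of the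
  Poisson process evaluates to \<open>exp (- lam * \<integral>p)\<close>. Inclusion-exclusion splits \<open>\<integral>p\<close> into
  three integrals over the plane: the first is radial and gives \<open>Gamma\<close>, the other two are
  symmetric about the line through source and relay and become the polar integrals over
  \<open>0 < \<theta> < pi\<close>, counted twice.
\<close>

text \<open>The points \<open>X i\<close> come from an arbitrary enumeration of the process and have
  no usable joint law; only the counts in bounded Borel sets are known. Infinitely many
  eavesdroppers are therefore reached through the first \<open>m\<close> of them: the events
  \<open>A m\<close> that none of these is in outage decrease to the absence of outage, and the
  generating functional is a limit of expected partial products, which in the limit depend on the
  counts alone. Conditioning is Fubini for product laws: the locations are split off first and then,
  for frozen locations, the coefficients of \<open>hsr\<close>. Beamforming sends vectors indexed by
  \<open>'n\<close> to vectors indexed by \<open>'m option\<close>, so it acts between different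
  types and a determinant argument does not apply directly. Invariance of Lebesgue measure is
  instead drawn from the uniqueness of translation-invariant measures; the same lemma also serves
  the rotations and the reflection of the plane and the passage from pairs to
  \<open>real ^ 2\<close>.\<close>

section \<open>Lebesgue measure under linear isometries\<close>

text \<open>For two translation-invariant measures, Fubini on \<open>{(x, y). x \<in> A \<and> x + y \<in> B}\<close> gives
  \<open>\<mu> A * \<nu> B = \<nu> (- A) * \<mu> B\<close>; take for \<open>A\<close> the unit ball.\<close>
lemma translation_invariant_eq_lborel:
  fixes \<mu> :: "'a::euclidean_space measure"
  assumes sets[measurable_cong]: "sets \<mu> = sets borel" and sf: "sigma_finite_measure \<mu>"
    and inv: "\<And>c. distr \<mu> borel ((+) c) = \<mu>"
    and ball: "emeasure \<mu> (ball 0 1) = emeasure lborel (ball (0::'a) 1)"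
  shows "\<mu> = lborel"
proof (rule measure_eqI)
  interpret \<mu>: sigma_finite_measure \<mu> by fact
  interpret P: pair_sigma_finite \<mu> "lborel :: 'a measure" ..
  have inv_nn: "(\<integral>\<^sup>+x. f (c + x) \<partial>\<mu>) = (\<integral>\<^sup>+x. f x \<partial>\<mu>)" if [measurable]: "f \<in> borel_measurable borel" for f c
    by (subst (2) inv[of c, symmetric], subst nn_integral_distr) auto
  have inv_lb: "(\<integral>\<^sup>+x. f (c + x) \<partial>lborel) = (\<integral>\<^sup>+x. f x \<partial>lborel)" if [measurable]: "f \<in> borel_measurable borel" for f :: "'a \<Rightarrow> ennreal" and c
    by (subst (2) lborel_distr_plus[of c, symmetric], subst nn_integral_distr) auto
  fix B assume "B \<in> sets \<mu>"
  then have [measurable]: "B \<in> sets borel" using sets by simp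
  define A where "A = ball (0::'a) 1"
  have [measurable]: "A \<in> sets borel" by (simp add: A_def)
  \<comment> \<open>The ball is its own negative, so the set \<open>- A\<close> produced by Fubini
    may be replaced by \<open>A\<close>, whose two measures agree by \<open>ball\<close>.\<close>
  have A_sym: "- x + y \<in> A \<longleftrightarrow> - y + x \<in> A" for x y
    by (simp add: A_def norm_minus_commute)
  have A_mult: "(\<integral>\<^sup>+x. indicator A x * c \<partial>\<mu>) = emeasure \<mu> A * c" for c
  proof -
    have "indicator A \<in> borel_measurable \<mu>" by measurable
    then show ?thesis by (subst nn_integral_multc) (auto simp: sets)
  qed
  have "emeasure \<mu> A * emeasure lborel B = (\<integral>\<^sup>+x. (\<integral>\<^sup>+y. indicator A x * indicator B y \<partial>lborel) \<partial>\<mu>)"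
    by (simp add: nn_integral_cmult A_mult)
  also have "\<dots> = (\<integral>\<^sup>+x. (\<integral>\<^sup>+y. indicator A x * indicator B (x + y) \<partial>lborel) \<partial>\<mu>)"
    using inv_lb[of "\<lambda>y. indicator A x * indicator B y" x for x] by simp
  also have "\<dots> = (\<integral>\<^sup>+y. (\<integral>\<^sup>+x. indicator A x * indicator B (x + y) \<partial>\<mu>) \<partial>lborel)"
    by (intro P.Fubini'[symmetric]) measurable
  also have "\<dots> = (\<integral>\<^sup>+y. (\<integral>\<^sup>+x. indicator A (- y + x) * indicator B x \<partial>\<mu>) \<partial>lborel)"
    using inv_nn[of "\<lambda>x. indicator A x * indicator B (x + y)" "- y" for y] by simp
  also have "\<dots> = (\<integral>\<^sup>+x. (\<integral>\<^sup>+y. indicator A (- y + x) * indicator B x \<partial>lborel) \<partial>\<mu>)"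
    by (intro P.Fubini') measurable
  also have "\<dots> = (\<integral>\<^sup>+x. (\<integral>\<^sup>+y. indicator A (- x + y) * indicator B x \<partial>lborel) \<partial>\<mu>)"
    by (intro nn_integral_cong) (simp add: indicator_def A_sym del: add_uminus_conv_diff uminus_add_conv_diff)
  also have "\<dots> = (\<integral>\<^sup>+x. (\<integral>\<^sup>+y. indicator A y * indicator B x \<partial>lborel) \<partial>\<mu>)"
    using inv_lb[of "\<lambda>y. indicator A y * indicator B x" "- x" for x] by simp
  also have "\<dots> = emeasure lborel A * emeasure \<mu> B"
    by (simp add: nn_integral_multc nn_integral_cmult)
  finally have "emeasure lborel A * emeasure lborel B = emeasure lborel A * emeasure \<mu> B"
    using ball by (simp add: A_def)
  moreover have "emeasure lborel A \<noteq> 0" "emeasure lborel A \<noteq> \<infinity>"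
    using emeasure_lborel_ball_finite[of "0::'a" 1] by (auto simp: A_def emeasure_ball ennreal_eq_0_iff not_le)
  ultimately show "emeasure \<mu> B = emeasure lborel B"
    by (metis ennreal_mult_cancel_left infinity_ennreal_def)
qed (use sets in simp)

text \<open>Translating by \<open>c = T d\<close> after \<open>T\<close> is translating by
  \<open>d\<close> before \<open>T\<close>, so the image measure is translation invariant. Balls
  around 0 pull back to balls of the same radius, and \<open>dim\<close> makes their volumes agree
  in both spaces.\<close>

lemma lborel_distr_linear_isometry:
  fixes T :: "'a::euclidean_space \<Rightarrow> 'b::euclidean_space"
  assumes T: "linear T" "\<And>x. norm (T x) = norm x" and surj: "surj T" and dim: "DIM('a) = DIM('b)"
  shows "distr lborel borel T = lborel"
proof (rule translation_invariant_eq_lborel)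
  have [measurable]: "T \<in> borel_measurable borel"
    using T(1) by (simp add: borel_measurable_continuous_onI linear_continuous_on linear_linear)
  have vb: "T -` ball 0 r = ball 0 r" for r using T(2) by auto
  show "distr (distr lborel borel T) borel ((+) c) = distr lborel borel T" for c
  proof -
    obtain d where d: "T d = c" using surj by (metis surjD)
    have "distr (distr lborel borel T) borel ((+) c) = distr lborel borel ((+) c \<circ> T)"
      by (simp add: distr_distr)
    also have "(+) c \<circ> T = T \<circ> (+) d"
      using d linear_add[OF T(1)] by (auto simp: fun_eq_iff)
    also have "distr lborel borel (T \<circ> (+) d) = distr (distr lborel borel ((+) d)) borel T"
      by (simp add: distr_distr)
    finally show ?thesis by (simp add: lborel_distr_plus)
  qed
  show "emeasure (distr lborel borel T) (ball 0 1) = emeasure lborel (ball 0 1 :: 'b set)"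
    using vb[of 1] by (simp add: emeasure_distr emeasure_ball dim)
  show "sigma_finite_measure (distr lborel borel T)"
  proof
    show "\<exists>A. countable A \<and> A \<subseteq> sets (distr lborel borel T) \<and> \<Union> A = space (distr lborel borel T) \<and>
             (\<forall>a\<in>A. emeasure (distr lborel borel T) a \<noteq> \<infinity>)"
    proof (intro exI[of _ "range (\<lambda>n. ball 0 (real n))"] conjI)
      show "\<Union> (range (\<lambda>n. ball 0 (real n))) = space (distr lborel borel T)"
        using reals_Archimedean2 by (auto simp: )
    qed (auto simp: emeasure_distr vb emeasure_ball)
  qed
qed simp

text \<open>A box in \<open>'a ^ 'n\<close> is a product of boxes in the components, because the
  basis consists of the \<open>axis i b\<close>. This is what turns a product of one-dimensional
  densities into a density on vectors.\<close>

lemma lborel_vec_eq_PiM: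
  "distr (Pi\<^sub>M UNIV (\<lambda>_::'n::finite. lborel :: 'a::euclidean_space measure)) borel vec_lambda =
     (lborel :: ('a ^ 'n) measure)"
proof (rule lborel_eqI[symmetric])
  interpret product_sigma_finite "\<lambda>_::'n. lborel :: 'a measure" ..
  have m: "vec_lambda \<in> measurable (Pi\<^sub>M UNIV (\<lambda>_::'n. lborel :: 'a measure)) borel"
    by (subst borel_measurable_euclidean_space) (auto simp: Basis_vec_def inner_axis)
  fix l u :: "'a ^ 'n" assume le: "\<And>b. b \<in> Basis \<Longrightarrow> l \<bullet> b \<le> u \<bullet> b"
  have le': "l $ i \<bullet> b \<le> u $ i \<bullet> b" if "b \<in> Basis" for i b
    using le[of "axis i b"] that by (simp add: inner_axis)
  have "emeasure (distr (Pi\<^sub>M UNIV (\<lambda>_::'n. lborel :: 'a measure)) borel vec_lambda) (box l u) =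
      emeasure (Pi\<^sub>M UNIV (\<lambda>_::'n. lborel :: 'a measure)) (Pi\<^sub>E UNIV (\<lambda>i. box (l $ i) (u $ i)))"
  proof -
    have "vec_lambda -` box l u \<inter> space (Pi\<^sub>M UNIV (\<lambda>_::'n. lborel :: 'a measure)) =
        Pi\<^sub>E UNIV (\<lambda>i. box (l $ i) (u $ i))"
      by (auto simp: space_PiM box_def Basis_vec_def inner_axis)
    then show ?thesis using m by (subst emeasure_distr) auto
  qed
  also have "\<dots> = (\<Prod>i\<in>UNIV. emeasure lborel (box (l $ i) (u $ i)))"
    by (rule emeasure_PiM) auto
  also have "\<dots> = (\<Prod>i\<in>UNIV. ennreal (\<Prod>b\<in>Basis. (u $ i - l $ i) \<bullet> b))"
    using le' by (intro prod.cong refl emeasure_lborel_box) auto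
  also have "\<dots> = ennreal (\<Prod>i\<in>UNIV. \<Prod>b\<in>Basis. (u $ i - l $ i) \<bullet> b)"
    using le' by (intro prod_ennreal prod_nonneg) (auto simp: inner_diff_left)
  also have "(\<Prod>i\<in>UNIV. \<Prod>b\<in>Basis. (u $ i - l $ i) \<bullet> b) = (\<Prod>b\<in>Basis. (u - l) \<bullet> b)"
  proof -
    have "(\<Prod>b\<in>Basis. (u - l) \<bullet> b) = (\<Prod>b\<in>(\<lambda>(i, b). axis i b) ` (UNIV \<times> Basis). (u - l) \<bullet> b)"
      by (intro prod.cong) (auto simp: Basis_vec_def)
    also have "\<dots> = (\<Prod>(i, b)\<in>UNIV \<times> Basis. (u - l) \<bullet> axis i b)"
      by (subst prod.reindex) (auto simp: inj_on_def axis_eq_axis case_prod_unfold)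
    finally show ?thesis by (simp add: prod.cartesian_product inner_axis)
  qed
  finally show "emeasure (distr (Pi\<^sub>M UNIV (\<lambda>_::'n. lborel :: 'a measure)) borel vec_lambda) (box l u) =
    ennreal (\<Prod>b\<in>Basis. (u - l) \<bullet> b)" .
qed simp

section \<open>Complex Gaussian vectors\<close>

text \<open>The disc of radius \<open>sqrt u\<close> has area \<open>pi * u\<close>. This removes
  the angle from radial integrals without polar coordinates, both for the Gaussian law and for the
  integral behind \<open>J1\<close>.\<close>

lemma distr_norm_square_lborel:
  assumes "DIM('a::euclidean_space) = 2"
  shows "distr lborel borel (\<lambda>x::'a. (norm x)\<^sup>2) = density lborel (\<lambda>u. ennreal (pi * indicator {0..} u))"
    (is "?D = ?E")
proof (rule measure_eqI_generator_eq)
  have eqn: "emeasure ?D {..u} = ennreal (pi * max 0 u)" for u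
  proof (cases "u \<ge> 0")
    case True
    then have "(\<lambda>x::'a. (norm x)\<^sup>2) -` {..u} = cball 0 (sqrt u)"
      by (auto simp: real_le_rsqrt real_le_lsqrt) (metis abs_norm_cancel real_sqrt_abs real_sqrt_le_iff sqrt_le_D)
    with True show ?thesis
      by (simp add: emeasure_distr emeasure_cball assms unit_ball_vol_2)
  next
    case False
    then have "(\<lambda>x::'a. (norm x)\<^sup>2) -` {..u} = {}"
      by auto (meson dual_order.trans zero_le_power2)
    with False show ?thesis by (simp add: emeasure_distr)
  qed
  have eqn': "emeasure ?E {..u} = ennreal (pi * max 0 u)" for u
  proof -
    have "emeasure ?E {..u} = (\<integral>\<^sup>+x. ennreal pi * indicator {0..u} x \<partial>lborel)"
      by (subst emeasure_density) (auto intro!: nn_integral_cong split: split_indicator)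
    also have "\<dots> = ennreal (pi * max 0 u)"
      by (subst nn_integral_cmult) (auto simp: emeasure_lborel_Icc_eq ennreal_mult'[symmetric] max_def)
    finally show ?thesis .
  qed
  show "emeasure ?D X = emeasure ?E X" if "X \<in> range atMost" for X
    using that eqn eqn' by auto
  show "sets ?D = sigma_sets UNIV (range atMost)" "sets ?E = sigma_sets UNIV (range atMost)"
    unfolding sets_distr sets_density sets_lborel by (subst borel_eq_atMost, simp add: full_SetCompr_eq)+
  show "(\<Union>i. {..real i}) = UNIV" using real_arch_simple by auto
  show "emeasure ?D {..real i} \<noteq> \<infinity>" for i by (simp add: eqn)
qed (auto simp: Int_stable_def)

lemma nn_integral_norm_square_lborel:
  assumes "DIM('a::euclidean_space) = 2" and [measurable]: "f \<in> borel_measurable borel"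
  shows "(\<integral>\<^sup>+x. f ((norm (x::'a))\<^sup>2) \<partial>lborel) = ennreal pi * (\<integral>\<^sup>+u. f u * indicator {0..} u \<partial>lborel)"
proof -
  have "(\<integral>\<^sup>+x. f ((norm (x::'a))\<^sup>2) \<partial>lborel) = (\<integral>\<^sup>+u. f u \<partial>distr lborel borel (\<lambda>x::'a. (norm x)\<^sup>2))"
    by (simp add: nn_integral_distr)
  also have "\<dots> = (\<integral>\<^sup>+u. ennreal (pi * indicator {0..} u) * f u \<partial>lborel)"
    by (simp add: distr_norm_square_lborel assms nn_integral_density)
  also have "\<dots> = (\<integral>\<^sup>+u. ennreal pi * (f u * indicator {0..} u) \<partial>lborel)"
    by (intro nn_integral_cong) (auto split: split_indicator)
  finally show ?thesis by (simp add: nn_integral_cmult)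
qed

lemma nn_integral_exp_atLeast:
  fixes a c :: real
  assumes "0 < c"
  shows "(\<integral>\<^sup>+u. ennreal (exp (- c * u)) * indicator {a..} u \<partial>lborel) = ennreal (exp (- c * a) / c)"
proof -
  have "(\<integral>\<^sup>+u. ennreal (exp (- c * u)) * indicator {a..} u \<partial>lborel) = ennreal (0 - (- exp (- c * a) / c))"
  proof (rule nn_integral_FTC_atLeast)
    show "((\<lambda>u. - exp (- c * u) / c) \<longlongrightarrow> 0) at_top"
      using assms by real_asymp
    show "((\<lambda>u. - exp (- c * u) / c) has_real_derivative exp (- c * u)) (at u)" for u
      using assms by (auto intro!: derivative_eq_intros simp: field_simps)
  qed auto
  then show ?thesis by simp
qed

text \<open>The law required by \<open>std_complex_gaussian\<close>, taken as a measure so that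
  products, images and Fubini apply to it.\<close>

definition cgauss :: "complex measure" where
  "cgauss = density lborel (\<lambda>z. ennreal (exp (- (cmod z)\<^sup>2) / pi))"

lemma sets_cgauss[simp, measurable_cong]: "sets cgauss = sets borel"
  and space_cgauss[simp]: "space cgauss = UNIV"
  by (auto simp: cgauss_def)

text \<open>The area constant \<open>pi\<close> cancels the normalisation of the density: the
  squared modulus is exponential with mean 1.\<close>

lemma nn_integral_cgauss_radial:
  assumes [measurable]: "f \<in> borel_measurable borel"
  shows "(\<integral>\<^sup>+z. f ((cmod z)\<^sup>2) \<partial>cgauss) = (\<integral>\<^sup>+u. ennreal (exp (- u)) * f u * indicator {0..} u \<partial>lborel)"
proof -
  have "(\<integral>\<^sup>+z. f ((cmod z)\<^sup>2) \<partial>cgauss) = (\<integral>\<^sup>+z. ennreal (exp (- (cmod z)\<^sup>2) / pi) * f ((cmod z)\<^sup>2) \<partial>lborel)"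
    unfolding cgauss_def by (subst nn_integral_density) auto
  also have "\<dots> = ennreal pi * (\<integral>\<^sup>+u. ennreal (exp (- u) / pi) * f u * indicator {0..} u \<partial>lborel)"
    by (rule nn_integral_norm_square_lborel) auto
  also have "\<dots> = (\<integral>\<^sup>+u. ennreal pi * (ennreal (exp (- u) / pi) * f u * indicator {0..} u) \<partial>lborel)"
    by (rule nn_integral_cmult[symmetric]) auto
  also have "\<dots> = (\<integral>\<^sup>+u. ennreal (exp (- u)) * f u * indicator {0..} u \<partial>lborel)"
    by (intro nn_integral_cong) (simp add: mult.assoc[symmetric] ennreal_mult'[symmetric])
  finally show ?thesis .
qed

text \<open>Laplace transform of the unit exponential law. Each artificial noise direction
  contributes one such factor; \<open>s = 0\<close> gives total mass 1.\<close>

lemma cgauss_laplace: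
  assumes "0 \<le> s"
  shows "(\<integral>\<^sup>+z. ennreal (exp (- s * (cmod z)\<^sup>2)) \<partial>cgauss) = ennreal (1 / (1 + s))"
proof -
  have "(\<integral>\<^sup>+z. ennreal (exp (- s * (cmod z)\<^sup>2)) \<partial>cgauss) =
      (\<integral>\<^sup>+u. ennreal (exp (- u)) * ennreal (exp (- s * u)) * indicator {0..} u \<partial>lborel)"
    by (rule nn_integral_cgauss_radial) simp
  also have "\<dots> = (\<integral>\<^sup>+u. ennreal (exp (- (1 + s) * u)) * indicator {0..} u \<partial>lborel)"
    by (simp add: ennreal_mult'[symmetric] exp_add[symmetric] algebra_simps)
  finally show ?thesis using nn_integral_exp_atLeast[of "1 + s" 0] assms by simp
qed

lemma cgauss_tail:
  assumes "0 \<le> t"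
  shows "emeasure cgauss {z. t < (cmod z)\<^sup>2} = ennreal (exp (- t))"
proof -
  have "emeasure cgauss {z. t < (cmod z)\<^sup>2} = (\<integral>\<^sup>+z. indicator {t<..} ((cmod z)\<^sup>2) \<partial>cgauss)"
  proof -
    have "(\<integral>\<^sup>+z. indicator {t<..} ((cmod z)\<^sup>2) \<partial>cgauss) = (\<integral>\<^sup>+z. indicator {z. t < (cmod z)\<^sup>2} z \<partial>cgauss)"
      by (intro nn_integral_cong) (auto split: split_indicator)
    also have "\<dots> = emeasure cgauss {z. t < (cmod z)\<^sup>2}"
      by (rule nn_integral_indicator) measurable
    finally show ?thesis by simp
  qed
  also have "\<dots> = (\<integral>\<^sup>+u. ennreal (exp (- u)) * indicator {t<..} u * indicator {0..} u \<partial>lborel)"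
    by (rule nn_integral_cgauss_radial) simp
  also have "\<dots> = (\<integral>\<^sup>+u. ennreal (exp (- 1 * u)) * indicator {t..} u \<partial>lborel)"
    using AE_lborel_singleton[of t] assms
    by (intro nn_integral_cong_AE) (auto elim!: eventually_mono split: split_indicator)
  finally show ?thesis using nn_integral_exp_atLeast[of 1 t] by simp
qed

lemma prob_space_cgauss: "prob_space cgauss"
  using cgauss_laplace[of 0] by (intro prob_spaceI) simp

text \<open>The product form matches independent entries; the density form derived below makes
  rotation invariance visible.\<close>

definition cgauss_vec :: "(complex ^ 'n) measure" where
  "cgauss_vec = distr (Pi\<^sub>M UNIV (\<lambda>_::'n. cgauss)) borel vec_lambda"

lemma measurable_vec_lambda[measurable]:
  "vec_lambda \<in> measurable (Pi\<^sub>M UNIV (\<lambda>_::'n::finite. borel :: 'a::euclidean_space measure)) borel"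
  by (subst borel_measurable_euclidean_space) (auto simp: Basis_vec_def inner_axis)

text \<open>It suffices to compare both sides on rectangles, where density and indicator split into
  factors of single coordinates.\<close>

lemma PiM_density_prod:
  fixes f :: "'i \<Rightarrow> 'a \<Rightarrow> ennreal"
  assumes fin: "finite I" and M: "\<And>i. sigma_finite_measure (M i)" "\<And>i. sigma_finite_measure (density (M i) (f i))"
    and f[measurable]: "\<And>i. f i \<in> borel_measurable (M i)"
  shows "Pi\<^sub>M I (\<lambda>i. density (M i) (f i)) = density (Pi\<^sub>M I M) (\<lambda>x. \<Prod>i\<in>I. f i (x i))"
proof (rule product_sigma_finite.PiM_eqI[symmetric])
  interpret product_sigma_finite M by (rule product_sigma_finite.intro) fact
  show "product_sigma_finite (\<lambda>i. density (M i) (f i))" by (rule product_sigma_finite.intro) fact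
  show "sets (density (Pi\<^sub>M I M) (\<lambda>x. \<Prod>i\<in>I. f i (x i))) = sets (Pi\<^sub>M I (\<lambda>i. density (M i) (f i)))"
    by (simp cong: sets_PiM_cong)
  fix A assume "\<And>i. i \<in> I \<Longrightarrow> A i \<in> sets (density (M i) (f i))"
  then have A: "\<And>i. i \<in> I \<Longrightarrow> A i \<in> sets (M i)" by simp
  have "emeasure (density (Pi\<^sub>M I M) (\<lambda>x. \<Prod>i\<in>I. f i (x i))) (Pi\<^sub>E I A) =
      (\<integral>\<^sup>+x. (\<Prod>i\<in>I. f i (x i)) * indicator (Pi\<^sub>E I A) x \<partial>Pi\<^sub>M I M)"
    using A fin by (subst emeasure_density) (auto intro!: sets_PiM_I_finite)
  also have "\<dots> = (\<integral>\<^sup>+x. (\<Prod>i\<in>I. f i (x i) * indicator (A i) (x i)) \<partial>Pi\<^sub>M I M)"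
    using fin by (intro nn_integral_cong)
      (auto simp: indicator_def prod.distrib space_PiM PiE_def Pi_def split: if_splits intro!: prod_zero)
  also have "\<dots> = (\<Prod>i\<in>I. \<integral>\<^sup>+x. f i x * indicator (A i) x \<partial>M i)"
    using A fin by (intro product_nn_integral_prod) auto
  also have "\<dots> = (\<Prod>i\<in>I. emeasure (density (M i) (f i)) (A i))"
    using A by (intro prod.cong refl) (simp add: emeasure_density)
  finally show "emeasure (density (Pi\<^sub>M I M) (\<lambda>x. \<Prod>i\<in>I. f i (x i))) (Pi\<^sub>E I A) = \<dots>" .
qed fact

text \<open>The exponents of the factors add up to the squared norm, so the joint density is a
  function of the norm alone.\<close>

lemma cgauss_vec_eq_density:
  "cgauss_vec = density lborel (\<lambda>h::complex^'n. ennreal (exp (- (norm h)\<^sup>2) / pi ^ CARD('n)))"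
proof -
  let ?L = "Pi\<^sub>M UNIV (\<lambda>_::'n. lborel :: complex measure)"
  let ?f = "\<lambda>h::complex^'n. ennreal (exp (- (norm h)\<^sup>2) / pi ^ CARD('n))"
  have m: "vec_lambda \<in> measurable ?L borel"
    using measurable_vec_lambda by (simp cong: measurable_cong_sets sets_PiM_cong)
  have "(\<Prod>i\<in>UNIV. ennreal (exp (- (cmod (x i))\<^sup>2) / pi)) = ?f (vec_lambda x)" for x :: "'n \<Rightarrow> complex"
    by (simp add: prod_ennreal prod_dividef exp_sum[symmetric] sum_negf norm_vec_def L2_set_def sum_nonneg)
  moreover have "sigma_finite_measure (density lborel (\<lambda>z. ennreal (exp (- (cmod z)\<^sup>2) / pi)))"
    using prob_space_cgauss unfolding cgauss_def by (simp add: prob_space_imp_sigma_finite)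
  ultimately have "Pi\<^sub>M UNIV (\<lambda>_::'n. cgauss) = density ?L (?f \<circ> vec_lambda)"
    unfolding cgauss_def
    by (subst PiM_density_prod) (auto simp: lborel.sigma_finite_measure_axioms comp_def)
  also have "distr \<dots> borel vec_lambda = density (distr ?L borel vec_lambda) ?f"
    using m by (subst density_distr) (auto simp: comp_def)
  finally show ?thesis by (simp add: cgauss_vec_def lborel_vec_eq_PiM)
qed

text \<open>The density depends only on the norm, which \<open>T\<close> keeps, and \<open>T\<close>
  carries Lebesgue measure to Lebesgue measure. Two index types are allowed because the target will
  be indexed by \<open>'m option\<close>; \<open>card\<close> equates the dimensions and the
  normalising powers of \<open>pi\<close>.\<close>

lemma distr_cgauss_vec_isometry:
  fixes T :: "complex ^ 'n \<Rightarrow> complex ^ 'k"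
  assumes T: "linear T" "\<And>x. norm (T x) = norm x" "surj T" and card: "CARD('n) = CARD('k)"
  shows "distr cgauss_vec borel T = cgauss_vec"
proof -
  have [measurable]: "T \<in> borel_measurable borel"
    using T(1) by (simp add: borel_measurable_continuous_onI linear_continuous_on linear_linear)
  let ?f = "\<lambda>h::complex^'k. ennreal (exp (- (norm h)\<^sup>2) / pi ^ CARD('k))"
  have "(cgauss_vec :: (complex^'n) measure) = density lborel (?f \<circ> T)"
    using T(2) card by (simp add: cgauss_vec_eq_density comp_def)
  also have "distr \<dots> borel T = density (distr lborel borel T) ?f"
    by (subst density_distr) (auto simp: comp_def)
  also have "distr lborel borel T = lborel"
    using T card by (intro lborel_distr_linear_isometry) auto
  finally show ?thesis by (simp add: cgauss_vec_eq_density)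
qed

text \<open>\<open>None\<close> is the signal direction, \<open>Some k\<close> a noise direction.
  Integrating out \<open>None\<close> first leaves the exponential tail at the random threshold;
  that tail is a product over the noise coordinates, each of which contributes its Laplace transform
  at \<open>s\<close>.\<close>

lemma cgauss_PiM_tail:
  assumes s: "0 \<le> s" and t: "0 \<le> t"
  shows "emeasure (Pi\<^sub>M UNIV (\<lambda>_::'m::finite option. cgauss))
      {z. s * (\<Sum>k\<in>UNIV. (cmod (z (Some k)))\<^sup>2) + t < (cmod (z None))\<^sup>2} = ennreal (exp (- t) * (1 / (1 + s)) ^ CARD('m))"
proof -
  interpret G: prob_space cgauss by (rule prob_space_cgauss)
  interpret product_sigma_finite "\<lambda>_::'m option. cgauss" ..
  let ?R = "range (Some :: 'm \<Rightarrow> 'm option)"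
  let ?A = "{z. s * (\<Sum>k\<in>UNIV. (cmod (z (Some k)))\<^sup>2) + t < (cmod (z None))\<^sup>2} :: ('m option \<Rightarrow> complex) set"
  have [measurable]: "?A \<in> sets (Pi\<^sub>M UNIV (\<lambda>_::'m option. cgauss))"
  proof -
    have "{z \<in> space (Pi\<^sub>M UNIV (\<lambda>_::'m option. cgauss)).
        s * (\<Sum>k\<in>UNIV. (cmod (z (Some k)))\<^sup>2) + t < (cmod (z None))\<^sup>2} \<in> sets (Pi\<^sub>M UNIV (\<lambda>_::'m option. cgauss))"
      by measurable
    then show ?thesis by (simp add: space_PiM)
  qed
  have U: "UNIV = insert None ?R" by (simp add: UNIV_option_conv)
  have "emeasure (Pi\<^sub>M UNIV (\<lambda>_::'m option. cgauss)) ?A = (\<integral>\<^sup>+z. indicator ?A z \<partial>Pi\<^sub>M (insert None ?R) (\<lambda>_. cgauss))"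
    by (simp add: U[symmetric])
  also have "\<dots> = (\<integral>\<^sup>+x. (\<integral>\<^sup>+y. indicator ?A (x(None := y)) \<partial>cgauss) \<partial>Pi\<^sub>M ?R (\<lambda>_. cgauss))"
    by (rule product_nn_integral_insert) (auto simp: U[symmetric])
  also have "\<dots> = (\<integral>\<^sup>+x. ennreal (exp (- t)) * (\<Prod>j\<in>?R. ennreal (exp (- s * (cmod (x j))\<^sup>2))) \<partial>Pi\<^sub>M ?R (\<lambda>_. cgauss))"
  proof (intro nn_integral_cong)
    fix x :: "'m option \<Rightarrow> complex"
    let ?S = "\<Sum>k\<in>UNIV. (cmod (x (Some k)))\<^sup>2"
    have "(\<integral>\<^sup>+y. indicator ?A (x(None := y)) \<partial>cgauss) = (\<integral>\<^sup>+y. indicator {y. s * ?S + t < (cmod y)\<^sup>2} y \<partial>cgauss)"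
      by (intro nn_integral_cong) (auto split: split_indicator)
    also have "\<dots> = emeasure cgauss {y. s * ?S + t < (cmod y)\<^sup>2}"
      by (rule nn_integral_indicator) measurable
    also have "\<dots> = ennreal (exp (- (s * ?S + t)))"
      using s t by (intro cgauss_tail add_nonneg_nonneg mult_nonneg_nonneg sum_nonneg) auto
    also have "\<dots> = ennreal (exp (- t)) * (\<Prod>j\<in>?R. ennreal (exp (- s * (cmod (x j))\<^sup>2)))"
      by (simp add: prod_ennreal exp_sum[symmetric] prod.reindex sum.reindex ennreal_mult'[symmetric]
          exp_add[symmetric] sum_distrib_left sum_negf)
    finally show "(\<integral>\<^sup>+y. indicator ?A (x(None := y)) \<partial>cgauss) = \<dots>" .
  qed
  also have "\<dots> = ennreal (exp (- t)) * (\<Prod>j\<in>?R. \<integral>\<^sup>+z. ennreal (exp (- s * (cmod z)\<^sup>2)) \<partial>cgauss)"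
    by (subst nn_integral_cmult, measurable) (subst product_nn_integral_prod, auto)
  also have "\<dots> = ennreal (exp (- t)) * ennreal ((1 / (1 + s)) ^ CARD('m))"
    using s by (simp only: cgauss_laplace) (simp add: card_image ennreal_power)
  finally show ?thesis by (simp add: ennreal_mult')
qed

section \<open>Outage probability of a single link\<close>

lemma vector_matrix_linear: "linear (\<lambda>h :: complex ^ 'n. h v* (W :: complex ^ 'k ^ 'n))"
  by (rule linearI) (simp_all add: vector_matrix_mult_def vec_eq_iff sum.distrib algebra_simps
      scaleR_sum_right)

lemma norm_vec_power2: "(norm (h :: complex ^ 'n))\<^sup>2 = (\<Sum>i\<in>UNIV. (cmod (h $ i))\<^sup>2)"
  by (simp add: norm_vec_def L2_set_def sum_nonneg)

text \<open>Used twice: for the noise block it shows that \<open>an_power\<close> is a squared norm,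
  hence nonnegative; for a unitary matrix it gives the isometry property.\<close>

lemma norm_vector_matrix_mult:
  fixes W :: "complex ^ 'k ^ 'n" and h :: "complex ^ 'n"
  shows "complex_of_real ((norm (h v* W))\<^sup>2) =
    scalar_product (h v* W v* ctranspose W) (\<chi> k. cnj (h $ k))"
proof -
  have "complex_of_real ((norm (h v* W))\<^sup>2) = (\<Sum>j\<in>UNIV. (h v* W) $ j * cnj ((h v* W) $ j))"
    by (simp only: norm_vec_power2 of_real_sum complex_norm_square)
  also have "\<dots> = (\<Sum>j\<in>UNIV. \<Sum>i\<in>UNIV. (h v* W) $ j * (cnj (W $ i $ j) * cnj (h $ i)))"
    by (subst (2) vector_matrix_mult_def) (simp add: sum_distrib_left mult_ac)
  also have "\<dots> = (\<Sum>i\<in>UNIV. \<Sum>j\<in>UNIV. (h v* W) $ j * (cnj (W $ i $ j) * cnj (h $ i)))"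
    by (rule sum.swap)
  also have "\<dots> = scalar_product (h v* W v* ctranspose W) (\<chi> k. cnj (h $ k))"
    by (simp add: scalar_product_def vector_matrix_mult_def[of "h v* W"] ctranspose_def
        transpose_def map_matrix_def sum_distrib_left sum_distrib_right mult_ac)
  finally show ?thesis .
qed

lemma an_power_eq_norm: "an_power A h = (norm (h v* A))\<^sup>2"
  unfolding an_power_def norm_vector_matrix_mult[symmetric] by (rule Re_complex_of_real)

text \<open>Each of the two equations in \<open>unitary_matrix\<close> has its task:
  \<open>W ** ctranspose W = mat 1\<close> preserves norms, and
  \<open>ctranspose W ** W = mat 1\<close> exhibits \<open>y v* ctranspose W\<close> as a preimage
  of \<open>y\<close>.\<close>

lemma unitary_vector_matrix_isometry:
  fixes W :: "complex ^ 'k ^ 'n"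
  assumes "unitary_matrix W"
  shows "norm (h v* W) = norm h" and "surj (\<lambda>h. h v* W)"
proof -
  have "complex_of_real ((norm (h v* W))\<^sup>2) = scalar_product h (\<chi> k. cnj (h $ k))"
    using assms unfolding norm_vector_matrix_mult by (simp add: vector_matrix_mul_assoc unitary_matrix_def)
  also have "\<dots> = complex_of_real ((norm h)\<^sup>2)"
    by (simp only: scalar_product_def norm_vec_power2 of_real_sum complex_norm_square vec_lambda_beta)
  finally show "norm (h v* W) = norm h" by (metis of_real_eq_iff norm_ge_zero power2_eq_iff_nonneg)
  show "surj (\<lambda>h. h v* W)"
  proof (rule surjI)
    show "y v* ctranspose W v* W = y" for y
      using assms by (simp add: vector_matrix_mul_assoc unitary_matrix_def)
  qed
qed

lemma beam_matrix_components:
  "(h v* beam_matrix w A) $ None = scalar_product h w"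
  "(h v* beam_matrix w A) $ Some k = (h v* A) $ k"
  by (simp_all add: vector_matrix_mult_def beam_matrix_def scalar_product_def mult_ac)

text \<open>Solved for the signal power, the outage condition is linear in the noise power. Rotating
  \<open>h\<close> by the unitary beam matrix turns signal and noise powers into squared moduli of
  independent standard Gaussian coordinates, where \<open>cgauss_PiM_tail\<close> applies.\<close>

lemma snr_source_outage:
  fixes w :: "complex ^ 'n" and A :: "complex ^ 'm ^ 'n"
  assumes unitary: "unitary_matrix (beam_matrix w A)"
    and N: "2 \<le> N" "CARD('n) = N" "CARD('m) = N - 1"
    and pos: "0 < \<beta>" "\<beta> \<le> 1" "0 < Ps" "0 < v1" "0 < \<tau>" "0 < d"
  shows "emeasure cgauss_vec {h. \<tau> < snr_source \<beta> Ps \<eta> v1 w A d h} =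
    ennreal (an_factor N \<beta> \<tau> * exp (- (\<tau> * v1 / (\<beta> * Ps) * d powr \<eta>)))"
proof -
  let ?T = "\<lambda>h. h v* beam_matrix w A"
  \<comment> \<open>Both constants arise from dividing the outage inequality by
    \<open>\<beta> * Ps * d powr (- \<eta>)\<close>: the path loss cancels in the weight
    \<open>s\<close> of the artificial noise and survives in the share \<open>t\<close> of the
    receiver noise.\<close>
  define s where "s = (1 - \<beta>) * \<tau> / (\<beta> * (real N - 1))"
  define t where "t = \<tau> * v1 / (\<beta> * Ps) * d powr \<eta>"
  have s: "0 \<le> s" and t: "0 \<le> t" using pos N by (auto simp: s_def t_def)
  let ?B = "{z. s * (\<Sum>k\<in>UNIV. (cmod (z (Some k)))\<^sup>2) + t < (cmod (z None))\<^sup>2} :: ('m option \<Rightarrow> complex) set"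
  let ?B' = "{z. s * (\<Sum>k\<in>UNIV. (cmod (z $ Some k))\<^sup>2) + t < (cmod (z $ None))\<^sup>2} :: (complex ^ 'm option) set"
  have eq: "\<tau> < snr_source \<beta> Ps \<eta> v1 w A d h \<longleftrightarrow> ?T h \<in> ?B'" for h
  proof -
    let ?U = "(cmod (scalar_product h w))\<^sup>2" and ?V = "an_power A h"
    have V: "?V = (\<Sum>k\<in>UNIV. (cmod ((h v* A) $ k))\<^sup>2)"
      by (simp add: an_power_eq_norm norm_vec_power2)
    have d: "0 < d powr \<eta>" "d powr (- \<eta>) = 1 / d powr \<eta>" using pos by (auto simp: powr_minus_divide)
    have den: "0 < (1 - \<beta>) / (real N - 1) * Ps * d powr (- \<eta>) * ?V + v1"
      using pos N by (intro add_nonneg_pos mult_nonneg_nonneg) (auto simp: an_power_eq_norm)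
    have "\<tau> < snr_source \<beta> Ps \<eta> v1 w A d h \<longleftrightarrow>
        \<tau> * ((1 - \<beta>) / (real N - 1) * Ps * d powr (- \<eta>) * ?V + v1) < \<beta> * Ps * d powr (- \<eta>) * ?U"
      using den by (simp add: snr_source_def N less_divide_eq)
    also have "\<dots> \<longleftrightarrow> (\<beta> * Ps * d powr (- \<eta>)) * (s * ?V + t) < (\<beta> * Ps * d powr (- \<eta>)) * ?U"
    proof -
      have "\<tau> * ((1 - \<beta>) / (real N - 1) * Ps * d powr (- \<eta>) * ?V + v1) = (\<beta> * Ps * d powr (- \<eta>)) * (s * ?V + t)"
        using pos N d by (simp add: s_def t_def field_simps)
      then show ?thesis by simp
    qed
    also have "\<dots> \<longleftrightarrow> s * ?V + t < ?U"
      using pos d by (intro mult_less_cancel_left_pos) auto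
    finally show ?thesis by (simp add: V beam_matrix_components)
  qed
  have card: "CARD('n) = CARD('m option)" using N by simp
  have [measurable]: "?T \<in> borel_measurable borel"
    using vector_matrix_linear[of "beam_matrix w A"]
    by (simp add: borel_measurable_continuous_onI linear_continuous_on linear_linear)
  have [measurable]: "?B' \<in> sets borel"
    by (intro borel_open open_Collect_less continuous_intros)
  have "emeasure cgauss_vec {h. \<tau> < snr_source \<beta> Ps \<eta> v1 w A d h} = emeasure (distr cgauss_vec borel ?T) ?B'"
    by (subst emeasure_distr) (auto simp: eq vimage_def cgauss_vec_def)
  also have "distr cgauss_vec borel ?T = cgauss_vec"
    using unitary_vector_matrix_isometry[OF unitary] card vector_matrix_linear
    by (intro distr_cgauss_vec_isometry) auto
  also have "emeasure cgauss_vec ?B' = emeasure (Pi\<^sub>M UNIV (\<lambda>_::'m option. cgauss)) ?B"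
    unfolding cgauss_vec_def
    by (subst emeasure_distr) (auto simp: vimage_def space_PiM cong: measurable_cong_sets sets_PiM_cong)
  also have "\<dots> = ennreal (exp (- t) * (1 / (1 + s)) ^ (N - 1))"
    using cgauss_PiM_tail[where 'm = 'm, OF s t] N by simp
  also have "(1 / (1 + s)) ^ (N - 1) = an_factor N \<beta> \<tau>"
  proof -
    have "an_factor N \<beta> \<tau> = (1 + s) powr (- real (N - 1))"
      using N by (simp add: an_factor_def s_def of_nat_diff)
    also have "\<dots> = (1 / (1 + s)) ^ (N - 1)"
      using s by (simp only: powr_minus powr_realpow) (simp add: power_divide inverse_eq_divide powr_realpow)
    finally show ?thesis by simp
  qed
  finally show ?thesis by (simp add: t_def mult.commute)
qed

lemma snr_relay_outage:
  assumes "0 < Pr" "0 < v2" "0 < \<tau>" "0 < d"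
  shows "emeasure cgauss {z. \<tau> < snr_relay Pr \<eta> v2 d z} = ennreal (exp (- (\<tau> * v2 / Pr * d powr \<eta>)))"
proof -
  have "{z. \<tau> < snr_relay Pr \<eta> v2 d z} = {z. \<tau> * v2 / Pr * d powr \<eta> < (cmod z)\<^sup>2}"
    using assms by (auto simp: snr_relay_def field_simps)
  then show ?thesis using assms by (simp add: cgauss_tail)
qed

section \<open>Generating functional of the Poisson process\<close>

context prob_space begin

text \<open>The probability generating function of a Poisson variable, summed from the exponential
  series. The rate \<open>\<mu> = 0\<close> is covered, as it occurs for null sets.\<close>

lemma expectation_poisson_power:
  fixes K :: "'a \<Rightarrow> nat"
  assumes K[measurable]: "K \<in> measurable M (count_space UNIV)"
    and poisson: "\<And>k. prob {\<omega> \<in> space M. K \<omega> = k} = \<mu> ^ k / fact k * exp (- \<mu>)"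
    and q: "0 \<le> q" "q \<le> 1" and mu: "0 \<le> \<mu>"
  shows "expectation (\<lambda>\<omega>. q ^ K \<omega>) = exp (- \<mu> * (1 - q))"
proof -
  have "(\<lambda>k. (q * \<mu>) ^ k /\<^sub>R fact k * exp (- \<mu>)) sums (exp (q * \<mu>) * exp (- \<mu>))"
    by (intro sums_mult2 exp_converges)
  then have sums: "(\<lambda>k. q ^ k * (\<mu> ^ k / fact k * exp (- \<mu>))) sums exp (- \<mu> * (1 - q))"
    by (simp add: power_mult_distrib exp_add[symmetric] field_simps)
  have "(\<integral>\<^sup>+\<omega>. ennreal (q ^ K \<omega>) \<partial>M) = (\<integral>\<^sup>+\<omega>. (\<Sum>k. ennreal (q ^ k) * indicator {\<omega> \<in> space M. K \<omega> = k} \<omega>) \<partial>M)"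
  proof (intro nn_integral_cong)
    fix \<omega> assume "\<omega> \<in> space M"
    then have "(\<Sum>k. ennreal (q ^ k) * indicator {\<omega> \<in> space M. K \<omega> = k} \<omega>) =
        (\<Sum>k\<in>{K \<omega>}. ennreal (q ^ k) * indicator {\<omega> \<in> space M. K \<omega> = k} \<omega>)"
      by (intro suminf_finite) auto
    with \<open>\<omega> \<in> space M\<close> show "ennreal (q ^ K \<omega>) = (\<Sum>k. ennreal (q ^ k) * indicator {\<omega> \<in> space M. K \<omega> = k} \<omega>)"
      by simp
  qed
  also have "\<dots> = (\<Sum>k. \<integral>\<^sup>+\<omega>. ennreal (q ^ k) * indicator {\<omega> \<in> space M. K \<omega> = k} \<omega> \<partial>M)"
    by (intro nn_integral_suminf) measurable
  also have "\<dots> = (\<Sum>k. ennreal (q ^ k * (\<mu> ^ k / fact k * exp (- \<mu>))))"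
    using q mu by (intro suminf_cong, subst nn_integral_cmult_indicator)
      (auto simp: emeasure_eq_measure poisson ennreal_mult'[symmetric])
  also have "\<dots> = ennreal (exp (- \<mu> * (1 - q)))"
    using q mu sums by (intro suminf_ennreal_eq) auto
  finally show ?thesis
    using q by (intro integral_eq_nn_integral[THEN trans]) auto
qed

text \<open>For a step function the partial product only depends on how many of the first
  \<open>m\<close> points lie in each \<open>B j\<close>. These numbers are eventually the full
  counts, which are independent Poisson variables, so the limit is a product of generating
  functions.\<close>

lemma pgfl_step_function:
  fixes X :: "nat \<Rightarrow> 'a \<Rightarrow> 'b::euclidean_space" and c :: "nat \<Rightarrow> real"
  assumes ppp: "homogeneous_ppp M lam \<Phi>" and lam: "0 \<le> lam"
    and enum: "AE \<omega> in M. bij_betw (\<lambda>i. X i \<omega>) UNIV (\<Phi> \<omega>)"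
    and X[measurable]: "\<And>i. X i \<in> borel_measurable M"
    and I: "finite I" and disj: "disjoint_family_on B I"
    and B: "\<And>j. j \<in> I \<Longrightarrow> B j \<in> sets borel" "\<And>j. j \<in> I \<Longrightarrow> bounded (B j)"
    and c: "\<And>j. j \<in> I \<Longrightarrow> 0 \<le> c j" "\<And>j. j \<in> I \<Longrightarrow> c j \<le> 1"
  defines "u \<equiv> \<lambda>x. \<Sum>j\<in>I. c j * indicator (B j) x"
  shows "(\<lambda>m. expectation (\<lambda>\<omega>. \<Prod>i<m. 1 - u (X i \<omega>))) \<longlonglongrightarrow> exp (- lam * (\<integral>x. u x \<partial>lborel))"
proof -
  let ?K = "\<lambda>j \<omega>. card (\<Phi> \<omega> \<inter> B j)"
  note [measurable] = B(1)
  have u_meas[measurable]: "u \<in> borel_measurable borel" unfolding u_def by measurable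
  \<comment> \<open>Disjointness puts \<open>x\<close> into at most one \<open>B j\<close>, so one
    minus a sum becomes a product, and indicators become exponents that add up to counts.\<close>
  have u_prod: "1 - u x = (\<Prod>j\<in>I. (1 - c j) ^ (if x \<in> B j then 1 else 0))" for x
  proof (cases "\<exists>j\<in>I. x \<in> B j")
    case True
    then obtain j where j: "j \<in> I" "x \<in> B j" by blast
    then have "x \<notin> B i" if "i \<in> I" "i \<noteq> j" for i
      using disj that by (auto simp: disjoint_family_on_def)
    then have "u x = (\<Sum>i\<in>I. if i = j then c j else 0)"
      "(\<Prod>i\<in>I. (1 - c i) ^ (if x \<in> B i then 1 else 0)) = (\<Prod>i\<in>I. if i = j then 1 - c j else 1)"
      using j unfolding u_def by (auto intro!: sum.cong prod.cong)
    with j I show ?thesis by simp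
  next
    case False then show ?thesis by (auto simp: u_def)
  qed
  have u_le: "0 \<le> 1 - u x" "1 - u x \<le> 1" for x
    using c unfolding u_prod by (auto intro!: prod_nonneg prod_le_1)
  have prod_eq: "(\<Prod>i<m. 1 - u (X i \<omega>)) = (\<Prod>j\<in>I. (1 - c j) ^ card {i. i < m \<and> X i \<omega> \<in> B j})" for m \<omega>
  proof -
    have "(\<Prod>i<m. 1 - u (X i \<omega>)) = (\<Prod>j\<in>I. \<Prod>i<m. (1 - c j) ^ (if X i \<omega> \<in> B j then 1 else 0))"
      unfolding u_prod by (rule prod.swap)
    also have "\<dots> = (\<Prod>j\<in>I. (1 - c j) ^ card {i. i < m \<and> X i \<omega> \<in> B j})"
      by (simp add: power_sum[symmetric] sum.If_cases Int_def)
    finally show ?thesis .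
  qed
  have conv: "(\<lambda>m. expectation (\<lambda>\<omega>. \<Prod>i<m. 1 - u (X i \<omega>))) \<longlonglongrightarrow> expectation (\<lambda>\<omega>. \<Prod>j\<in>I. (1 - c j) ^ ?K j \<omega>)"
  proof (rule integral_dominated_convergence[where w = "\<lambda>_. 1"])
    show "(\<lambda>\<omega>. \<Prod>j\<in>I. (1 - c j) ^ ?K j \<omega>) \<in> borel_measurable M"
    proof -
      have "?K j \<in> measurable M (count_space UNIV)" if "j \<in> I" for j
        using ppp B that unfolding homogeneous_ppp_def by blast
      then show ?thesis by (intro borel_measurable_prod) (auto intro!: measurable_compose[where g = "\<lambda>k. (1 - c _) ^ k"])
    qed
    have "AE \<omega> in M. \<forall>B. bounded B \<longrightarrow> finite (\<Phi> \<omega> \<inter> B)"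
      using ppp unfolding homogeneous_ppp_def by blast
    with enum show "AE \<omega> in M. (\<lambda>m. \<Prod>i<m. 1 - u (X i \<omega>)) \<longlonglongrightarrow> (\<Prod>j\<in>I. (1 - c j) ^ ?K j \<omega>)"
    proof eventually_elim
      case (elim \<omega>)
      \<comment> \<open>Only finitely many indices hit \<open>B j\<close>: the process is finite on
        this bounded set and the enumeration is injective. Beyond the largest such index nothing
        changes.\<close>
      have "\<forall>\<^sub>F m in sequentially. card {i. i < m \<and> X i \<omega> \<in> B j} = ?K j \<omega>" if j: "j \<in> I" for j
      proof -
        let ?J = "{i. X i \<omega> \<in> B j}"
        have im: "(\<lambda>i. X i \<omega>) ` ?J = \<Phi> \<omega> \<inter> B j" and inj: "inj_on (\<lambda>i. X i \<omega>) ?J"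
          using elim(1) by (auto simp: bij_betw_def intro: inj_on_subset)
        then have fin: "finite ?J" using elim(2) B(2)[OF j] by (metis finite_imageD)
        then obtain m0 where m0: "\<forall>i\<in>?J. i < m0" using finite_nat_set_iff_bounded by blast
        have "card {i. i < m \<and> X i \<omega> \<in> B j} = ?K j \<omega>" if "m \<ge> m0" for m
        proof -
          have "{i. i < m \<and> X i \<omega> \<in> B j} = ?J" using m0 that by fastforce
          then show ?thesis using card_image[OF inj] im by simp
        qed
        then show ?thesis by (auto simp: eventually_sequentially)
      qed
      then have "\<forall>\<^sub>F m in sequentially. \<forall>j\<in>I. card {i. i < m \<and> X i \<omega> \<in> B j} = ?K j \<omega>"
        using I by (simp add: eventually_ball_finite)
      then show ?case
        by (intro tendsto_eventually) (auto simp: prod_eq elim!: eventually_mono)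
    qed
    show "AE \<omega> in M. norm (\<Prod>i<m. 1 - u (X i \<omega>)) \<le> 1" for m
      using u_le by (auto intro!: AE_I2 prod_le_1 simp: abs_prod)
  qed auto
  have indep: "indep_vars (\<lambda>_. count_space UNIV) ?K I"
    using ppp I disj B unfolding homogeneous_ppp_def by blast
  have "indep_vars (\<lambda>_. borel) (\<lambda>j \<omega>. (1 - c j) ^ ?K j \<omega>) I"
    by (rule indep_vars_compose2[OF indep]) auto
  then have "expectation (\<lambda>\<omega>. \<Prod>j\<in>I. (1 - c j) ^ ?K j \<omega>) = (\<Prod>j\<in>I. expectation (\<lambda>\<omega>. (1 - c j) ^ ?K j \<omega>))"
  proof (rule indep_vars_lebesgue_integral[OF I])
    fix j assume j: "j \<in> I"
    have [measurable]: "?K j \<in> measurable M (count_space UNIV)"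
      using ppp B j unfolding homogeneous_ppp_def by blast
    show "integrable M (\<lambda>\<omega>. (1 - c j) ^ ?K j \<omega>)"
      using c[OF j] by (intro integrable_const_bound[of _ 1]) (auto intro!: power_le_one)
  qed
  also have "\<dots> = (\<Prod>j\<in>I. exp (- (lam * measure lborel (B j)) * c j))"
  proof (intro prod.cong refl)
    fix j assume j: "j \<in> I"
    have "expectation (\<lambda>\<omega>. (1 - c j) ^ ?K j \<omega>) = exp (- (lam * measure lborel (B j)) * (1 - (1 - c j)))"
      using ppp B j c[OF j] lam unfolding homogeneous_ppp_def
      by (intro expectation_poisson_power) auto
    then show "expectation (\<lambda>\<omega>. (1 - c j) ^ ?K j \<omega>) = exp (- (lam * measure lborel (B j)) * c j)" by simp
  qed
  also have "\<dots> = exp (- lam * (\<integral>x. u x \<partial>lborel))"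
  proof -
    have fin: "emeasure lborel (B j) < \<infinity>" if "j \<in> I" for j
      using B(2)[OF that] by (rule emeasure_bounded_finite)
    have "(\<integral>x. u x \<partial>lborel) = (\<Sum>j\<in>I. c j * measure lborel (B j))"
      unfolding u_def using B fin
      by (subst Bochner_Integration.integral_sum) (auto intro!: integrable_mult_right integrable_real_indicator)
    then show ?thesis using I by (simp add: exp_sum[symmetric] sum_distrib_left sum_negf mult_ac)
  qed
  finally show ?thesis using conv by simp
qed

lemma pgfl_simple_function:
  fixes X :: "nat \<Rightarrow> 'a \<Rightarrow> 'b::euclidean_space" and u :: "'b \<Rightarrow> real"
  assumes ppp: "homogeneous_ppp M lam \<Phi>" "0 \<le> lam"
    "AE \<omega> in M. bij_betw (\<lambda>i. X i \<omega>) UNIV (\<Phi> \<omega>)" "\<And>i. X i \<in> borel_measurable M"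
    and u: "simple_function borel u" "\<And>x. 0 \<le> u x" "\<And>x. u x \<le> 1" "bounded {x. u x \<noteq> 0}"
  shows "(\<lambda>m. expectation (\<lambda>\<omega>. \<Prod>i<m. 1 - u (X i \<omega>))) \<longlonglongrightarrow> exp (- lam * (\<integral>x. u x \<partial>lborel))"
proof -
  \<comment> \<open>The value 0 is left out because its level set is unbounded; the other level sets
    lie in the bounded support of \<open>u\<close>.\<close>
  let ?V = "range u - {0}"
  have "finite ?V" using simple_functionD(1)[OF u(1)] by simp
  then obtain n h where h: "bij_betw h {0..<n::nat} ?V"
    using ex_bij_betw_nat_finite by metis
  let ?B = "\<lambda>j. u -` {h j}"
  have hV: "h j \<in> ?V" if "j \<in> {0..<n}" for j using h that by (auto simp: bij_betw_def)
  have eq: "u x = (\<Sum>j\<in>{0..<n}. h j * indicator (?B j) x)" for x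
  proof -
    have "(\<Sum>j\<in>{0..<n}. h j * indicator (?B j) x) = (\<Sum>v\<in>?V. v * indicator (u -` {v}) x)"
      by (rule sum.reindex_bij_betw[OF h])
    also have "\<dots> = (\<Sum>v\<in>?V. if v = u x then v else 0)"
      by (intro sum.cong) (auto simp: indicator_def)
    also have "\<dots> = u x" using \<open>finite ?V\<close> by (auto simp: sum.delta)
    finally show ?thesis ..
  qed
  have "(\<lambda>m. expectation (\<lambda>\<omega>. \<Prod>i<m. 1 - (\<Sum>j\<in>{0..<n}. h j * indicator (?B j) (X i \<omega>))))
      \<longlonglongrightarrow> exp (- lam * (\<integral>x. (\<Sum>j\<in>{0..<n}. h j * indicator (?B j) x) \<partial>lborel))"
  proof (rule pgfl_step_function[OF ppp])
    show "disjoint_family_on ?B {0..<n}"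
      using h by (auto simp: disjoint_family_on_def bij_betw_def inj_on_def)
    show "?B j \<in> sets borel" if "j \<in> {0..<n}" for j
      using simple_functionD(2)[OF u(1), of "{h j}"] by simp
    show "bounded (?B j)" if "j \<in> {0..<n}" for j
      using hV[OF that] by (intro bounded_subset[OF u(4)]) auto
    show "0 \<le> h j" "h j \<le> 1" if "j \<in> {0..<n}" for j
      using hV[OF that] u(2,3) by auto
  qed simp
  then show ?thesis by (simp only: eq[symmetric])
qed

text \<open>The limits in \<open>m\<close> and in the approximation of \<open>p\<close> need not be
  interchanged: monotonicity squeezes the expectations. The lower bound holds for every
  \<open>m\<close>, and each approximation \<open>u n\<close> from below gives an upper bound whose
  limit in \<open>m\<close> is known.\<close>

theorem poisson_pgfl:
  fixes X :: "nat \<Rightarrow> 'a \<Rightarrow> 'b::euclidean_space" and p :: "'b \<Rightarrow> real"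
  assumes ppp: "homogeneous_ppp M lam \<Phi>" "0 \<le> lam"
    "AE \<omega> in M. bij_betw (\<lambda>i. X i \<omega>) UNIV (\<Phi> \<omega>)" and X[measurable]: "\<And>i. X i \<in> borel_measurable M"
    and p: "integrable lborel p" "\<And>x. 0 \<le> p x" "\<And>x. p x \<le> 1"
  shows "(\<lambda>m. expectation (\<lambda>\<omega>. \<Prod>i<m. 1 - p (X i \<omega>))) \<longlonglongrightarrow> exp (- lam * (\<integral>x. p x \<partial>lborel))"
proof -
  have p_meas[measurable]: "p \<in> borel_measurable borel" using p(1) by (simp add: borel_measurable_integrable measurable_lborel1)
  obtain f where f: "\<And>n. simple_function borel (f n)" "incseq f" "\<And>x n. 0 \<le> f n x" "\<And>x. (\<lambda>n. f n x) \<longlonglongrightarrow> p x"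
  proof -
    obtain f where f: "incseq f" "\<And>i. simple_function borel (f i)" "\<And>x. bdd_above (range (\<lambda>i. f i x))"
        "\<And>i x. 0 \<le> f i x" "p = (SUP i. f i)"
      using borel_measurable_implies_simple_function_sequence_real[OF p_meas p(2)] by blast
    have "(\<lambda>n. f n x) \<longlonglongrightarrow> p x" for x
    proof -
      have "(\<lambda>n. f n x) \<longlonglongrightarrow> (SUP i. f i x)"
        using f(1,3) by (intro LIMSEQ_incseq_SUP) (auto simp: incseq_def le_fun_def)
      then show ?thesis by (simp add: f(5) image_image)
    qed
    with f show ?thesis by (intro that[of f])
  qed
  \<comment> \<open>Cutting to growing balls supplies the bounded support needed for the counts; at
    each point the cut eventually has no effect.\<close>
  define u where "u n x = f n x * indicator (ball 0 (real n)) x" for n x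
  have f_le: "f n x \<le> p x" for n x
    using f(2,4) by (intro incseq_le) (auto simp: incseq_def le_fun_def)
  have u_le: "u n x \<le> p x" "0 \<le> u n x" for n x
    using f_le[of n x] f(3)[of n x] p(2)[of x] by (auto simp: u_def split: split_indicator)
  have u_le1: "u n x \<le> 1" for n x using u_le(1) p(3) order_trans by blast
  have simple: "simple_function borel (u n)" for n
    unfolding u_def by (intro simple_function_mult f simple_function_indicator) simp
  have u_meas[measurable]: "u n \<in> borel_measurable borel" for n
    using simple by (rule borel_measurable_simple_function)
  have u_lim: "(\<lambda>n. u n x) \<longlonglongrightarrow> p x" for x
  proof -
    obtain n0 where "norm x < real n0" using reals_Archimedean2 by blast
    then have "\<forall>\<^sub>F n in sequentially. f n x = u n x"
      by (auto simp: u_def eventually_sequentially intro!: exI[of _ n0])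
    then show ?thesis using f(4) by (rule Lim_transform_eventually[rotated])
  qed
  let ?E = "\<lambda>q m. expectation (\<lambda>\<omega>. \<Prod>i<m. 1 - q (X i \<omega>))"
  have int: "integrable M (\<lambda>\<omega>. \<Prod>i<m. 1 - q (X i \<omega>))"
    if [measurable]: "q \<in> borel_measurable borel" and "\<And>x. 0 \<le> q x" "\<And>x. q x \<le> 1" for q :: "'b \<Rightarrow> real" and m
    using that by (intro integrable_const_bound[of _ 1]) (auto intro!: AE_I2 prod_le_1 simp: abs_prod)
  have e_lim: "(\<lambda>n. exp (- lam * (\<integral>x. u n x \<partial>lborel))) \<longlonglongrightarrow> exp (- lam * (\<integral>x. p x \<partial>lborel))"
    using u_lim u_le by (intro tendsto_intros integral_dominated_convergence[where w = p] p(1)) (auto simp: abs_of_nonneg)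
  have u_pgfl: "?E (u n) \<longlonglongrightarrow> exp (- lam * (\<integral>x. u n x \<partial>lborel))" for n
  proof (rule pgfl_simple_function[OF ppp X simple u_le(2) u_le1])
    show "bounded {x. u n x \<noteq> 0}" by (rule bounded_subset[OF bounded_ball[of 0 "real n"]])
      (auto simp: u_def indicator_def split: if_splits)
  qed
  \<comment> \<open>One more factor from the unit interval can only decrease the product, so every
    partial expectation dominates its limit in \<open>m\<close>.\<close>
  have decr: "?E (u n) (Suc m) \<le> ?E (u n) m" for n m
    using u_le(2) u_le1 by (intro integral_mono int) (auto intro!: mult_left_le prod_nonneg)
  \<comment> \<open>For fixed \<open>m\<close>, let \<open>n\<close> tend to infinity in the
    inequality between the partial expectation of \<open>u n\<close> and its limit.\<close>
  have lower: "exp (- lam * (\<integral>x. p x \<partial>lborel)) \<le> ?E p m" for m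
  proof (rule LIMSEQ_le[OF e_lim])
    show "(\<lambda>n. ?E (u n) m) \<longlonglongrightarrow> ?E p m"
    proof (rule integral_dominated_convergence[where w = "\<lambda>_. 1"])
      show "AE \<omega> in M. (\<lambda>n. \<Prod>i<m. 1 - u n (X i \<omega>)) \<longlonglongrightarrow> (\<Prod>i<m. 1 - p (X i \<omega>))"
        by (intro AE_I2 tendsto_prod tendsto_diff tendsto_const u_lim)
      show "AE \<omega> in M. norm (\<Prod>i<m. 1 - u n (X i \<omega>)) \<le> 1" for n
        using u_le(2) u_le1 by (intro AE_I2) (auto intro!: prod_le_1 simp: abs_prod)
    qed auto
    show "\<exists>N. \<forall>n\<ge>N. exp (- lam * (\<integral>x. u n x \<partial>lborel)) \<le> ?E (u n) m"
      using decseq_ge[OF decseq_SucI u_pgfl] decr by blast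
  qed
  have upper: "?E p m \<le> ?E (u n) m" for n m
    using u_le u_le1 p by (intro integral_mono int) (auto intro!: prod_mono)
  show ?thesis
  proof (rule order_tendstoI)
    fix a assume "exp (- lam * (\<integral>x. p x \<partial>lborel)) < a"
    then obtain n where "exp (- lam * (\<integral>x. u n x \<partial>lborel)) < a"
      using eventually_happens'[OF sequentially_bot order_tendstoD(2)[OF e_lim]] by blast
    then have "\<forall>\<^sub>F m in sequentially. ?E (u n) m < a"
      using order_tendstoD(2)[OF u_pgfl] by blast
    then show "\<forall>\<^sub>F m in sequentially. ?E p m < a"
      by (rule eventually_mono) (rule le_less_trans[OF upper])
  next
    fix a assume "a < exp (- lam * (\<integral>x. p x \<partial>lborel))"
    then show "\<forall>\<^sub>F m in sequentially. a < ?E p m" by (intro always_eventually allI less_le_trans[OF _ lower])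
  qed
qed

end

section \<open>Polar coordinates in the plane\<close>

text \<open>The substitution \<open>t = a * u powr k\<close> turns the integral into the Euler
  integral of \<open>Gamma (1 / k)\<close>.\<close>

lemma has_integral_exp_powr:
  fixes a k :: real
  assumes a: "0 < a" and k: "0 < k"
  shows "((\<lambda>u. exp (- (a * u powr k))) has_integral (1 / k * a powr (- (1 / k)) * Gamma (1 / k))) {0<..}"
proof -
  \<comment> \<open>The inverse of \<open>u\<close> going to \<open>a * u powr k\<close>;
    \<open>g'\<close> is its derivative.\<close>
  define g where "g t = (t / a) powr (1 / k)" for t :: real
  define g' where "g' t = 1 / k * (t / a) powr (1 / k - 1) / a" for t :: real
  let ?f = "\<lambda>u. exp (- (a * u powr k))"
  have img: "g ` {0<..} = {0<..}"
  proof (intro equalityI subsetI)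
    fix u :: real assume "u \<in> {0<..}"
    then show "u \<in> g ` {0<..}"
      using a k by (intro image_eqI[of _ _ "a * u powr k"]) (auto simp: g_def powr_powr)
  qed (use a in \<open>auto simp: g_def\<close>)
  have inj: "inj_on g {0<..}"
  proof (rule inj_onI)
    fix s t :: real assume "s \<in> {0<..}" "t \<in> {0<..}" "g s = g t"
    then have "g s powr k = g t powr k" by simp
    with \<open>s \<in> {0<..}\<close> \<open>t \<in> {0<..}\<close> show "s = t"
      using a k by (simp add: g_def powr_powr)
  qed
  have der: "(g has_field_derivative g' t) (at t within {0<..})" if "t \<in> {0<..}" for t
    using a that unfolding g_def g'_def
    by (auto intro!: derivative_eq_intros simp: field_simps powr_diff)
  have eq: "\<bar>g' t\<bar> * ?f (g t) = (1 / k * a powr (- (1 / k))) * (t powr (1 / k - 1) / exp t)" if "t \<in> {0<..}" for t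
  proof -
    have "a powr (1 / k - 1) * a = a powr (1 / k)" using a by (simp add: powr_diff)
    then have 1: "(t / a) powr (1 / k - 1) / a = t powr (1 / k - 1) / a powr (1 / k)"
      using a that by (simp add: powr_divide)
    have 2: "a * g t powr k = t" using a k that by (simp add: g_def powr_powr)
    have "g' t = 1 / k * ((t / a) powr (1 / k - 1) / a)" by (simp add: g'_def)
    then have 3: "g' t = 1 / k * (t powr (1 / k - 1) / a powr (1 / k))" by (simp only: 1)
    then have "\<bar>g' t\<bar> = g' t" using k by simp
    then show ?thesis by (simp add: 2 3 powr_minus exp_minus divide_inverse mult_ac)
  qed
  \<comment> \<open>The endpoint 0 is dropped from the Euler integral because the derivative of
    \<open>g\<close> is available only for positive \<open>t\<close>.\<close>
  have "((\<lambda>t. t powr (1 / k - 1) / exp t) has_integral Gamma (1 / k)) {0<..}"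
    using Gamma_integral_real[of "1 / k"] k
    by (subst has_integral_spike_set_eq[of _ "{0..}"])
      (auto intro!: negligible_subset[OF negligible_sing[of "0::real"]])
  from has_integral_mult_right[OF this, of "1 / k * a powr (- (1 / k))"]
  have I: "((\<lambda>t. \<bar>g' t\<bar> * ?f (g t)) has_integral (1 / k * a powr (- (1 / k)) * Gamma (1 / k))) {0<..}"
    by (rule has_integral_eq[rotated]) (use eq in auto)
  then have "(\<lambda>t. \<bar>g' t\<bar> * ?f (g t)) absolutely_integrable_on {0<..}"
    by (intro nonnegative_absolutely_integrable_1) (auto simp: has_integral_iff)
  then have "?f absolutely_integrable_on (g ` {0<..}) \<and>
      integral (g ` {0<..}) ?f = 1 / k * a powr (- (1 / k)) * Gamma (1 / k)"
    using has_absolute_integral_change_of_variables_1'[OF _ der inj, of ?f] I by (auto simp: has_integral_iff)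
  then show ?thesis
    by (simp add: img has_integral_iff absolutely_integrable_on_def)
qed

text \<open>In the variable \<open>u\<close>, the squared norm, the exponent \<open>\<eta>\<close>
  becomes \<open>\<eta> / 2\<close>, so the one-dimensional integral applies with
  \<open>k = \<eta> / 2\<close>; this is the origin of \<open>2 / \<eta>\<close>.\<close>

lemma nn_integral_exp_norm_powr:
  fixes a \<eta> :: real
  assumes "DIM('a::euclidean_space) = 2" and a: "0 < a" and eta: "0 < \<eta>"
  shows "(\<integral>\<^sup>+x. ennreal (exp (- (a * norm (x::'a) powr \<eta>))) \<partial>lborel) =
    ennreal (2 * pi / \<eta> * a powr (- (2 / \<eta>)) * Gamma (2 / \<eta>))"
proof -
  let ?c = "1 / (\<eta> / 2) * a powr (- (1 / (\<eta> / 2))) * Gamma (1 / (\<eta> / 2))"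
  have "(\<integral>\<^sup>+x. ennreal (exp (- (a * norm (x::'a) powr \<eta>))) \<partial>lborel) =
      (\<integral>\<^sup>+x. ennreal (exp (- (a * ((norm (x::'a))\<^sup>2) powr (\<eta> / 2)))) \<partial>lborel)"
  proof -
    have "((norm x)\<^sup>2) powr (\<eta> / 2) = norm x powr \<eta>" for x :: 'a
    proof -
      have "norm x powr \<eta> = (norm x powr 2) powr (\<eta> / 2)" by (simp only: powr_powr) simp
      then show ?thesis by simp
    qed
    then show ?thesis by simp
  qed
  also have "\<dots> = ennreal pi * (\<integral>\<^sup>+u. ennreal (exp (- (a * u powr (\<eta> / 2)))) * indicator {0..} u \<partial>lborel)"
    by (rule nn_integral_norm_square_lborel) (use assms in auto)
  also have "(\<integral>\<^sup>+u. ennreal (exp (- (a * u powr (\<eta> / 2)))) * indicator {0..} u \<partial>lborel) =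
      (\<integral>\<^sup>+u. ennreal (indicator {0<..} u * exp (- (a * u powr (\<eta> / 2)))) \<partial>lborel)"
    using AE_lborel_singleton[of "0::real"]
    by (intro nn_integral_cong_AE) (auto elim!: eventually_mono split: split_indicator)
  also have "\<dots> = ennreal ?c"
    using a eta by (intro nn_integral_has_integral_lebesgue has_integral_exp_powr) auto
  finally show ?thesis by (simp add: ennreal_mult'[symmetric] mult_ac)
qed

lemma
  fixes a \<eta> :: real
  assumes "DIM('a::euclidean_space) = 2" and "0 < a" and "0 < \<eta>"
  shows integrable_exp_norm_powr: "integrable lborel (\<lambda>x::'a. exp (- (a * norm (x - c) powr \<eta>)))"
    and integral_exp_norm_powr: "(\<integral>x. exp (- (a * norm (x::'a) powr \<eta>)) \<partial>lborel) =
      2 * pi / \<eta> * a powr (- (2 / \<eta>)) * Gamma (2 / \<eta>)"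
proof -
  have G: "0 \<le> 2 * pi / \<eta> * a powr (- (2 / \<eta>)) * Gamma (2 / \<eta>)"
    using assms by (intro mult_nonneg_nonneg) (auto intro: less_imp_le Gamma_real_pos)
  have int: "integrable lborel (\<lambda>x::'a. exp (- (a * norm x powr \<eta>)))"
    using nn_integral_exp_norm_powr[OF assms] by (intro integrableI_nonneg) auto
  have "integrable (distr lborel borel ((+) (- c))) (\<lambda>x::'a. exp (- (a * norm x powr \<eta>)))"
    using int by (simp add: lborel_distr_plus)
  then show "integrable lborel (\<lambda>x::'a. exp (- (a * norm (x - c) powr \<eta>)))"
    by (subst (asm) integrable_distr_eq) auto
  show "(\<integral>x. exp (- (a * norm (x::'a) powr \<eta>)) \<partial>lborel) = 2 * pi / \<eta> * a powr (- (2 / \<eta>)) * Gamma (2 / \<eta>)"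
    using nn_integral_exp_norm_powr[OF assms] G by (intro integral_eq_nn_integral[THEN trans]) auto
qed

abbreviation vec2 :: "real \<Rightarrow> real \<Rightarrow> real ^ 2" where
  "vec2 x y \<equiv> vector [x, y]"

lemma norm_real2_power2: "(norm (x :: real ^ 2))\<^sup>2 = (x $ 1)\<^sup>2 + (x $ 2)\<^sup>2"
  by (simp add: norm_vec_def L2_set_def sum_2)

text \<open>The change of variables takes place in \<open>real ^ 2\<close>, the iterated integral
  lives on pairs; this lemma carries integrals from one to the other.\<close>

lemma lborel_vec2: "distr (lborel :: (real \<times> real) measure) borel (\<lambda>(x, y). vec2 x y) = lborel"
proof (rule lborel_distr_linear_isometry)
  show "linear (\<lambda>(x, y). vec2 x y)"
    by (rule linearI) (auto simp: vec_eq_iff forall_2)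
  show "norm (case z of (x, y) \<Rightarrow> vec2 x y) = norm z" for z :: "real \<times> real"
    by (rule power2_eq_imp_eq) (auto simp: norm_real2_power2 norm_Pair split: prod.splits)
  show "surj (\<lambda>(x, y). vec2 x y)"
    by (rule surjI[of _ "\<lambda>v. (v $ 1, v $ 2)"]) (simp add: vec_eq_iff forall_2)
qed simp

text \<open>Restricting to the upper half plane makes the polar map injective on an open set, and the angle
  is then \<open>arccos\<close> of the normalised abscissa.\<close>
lemma polar_image:
  "(\<lambda>x::real^2. vec2 (x $ 1 * cos (x $ 2)) (x $ 1 * sin (x $ 2))) ` {x. 0 < x $ 1 \<and> 0 < x $ 2 \<and> x $ 2 < pi} = {x. 0 < x $ 2}"
    (is "?g ` ?S = ?H")
proof (intro equalityI subsetI)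
  fix y assume "y \<in> ?H"
  then have y: "0 < y $ 2" by simp
  define r where "r = norm y"
  define c where "c = y $ 1 / r"
  have r: "0 < r" using y by (auto simp: r_def)
  have r2: "r\<^sup>2 = (y $ 1)\<^sup>2 + (y $ 2)\<^sup>2" by (simp add: r_def norm_real2_power2)
  have "c\<^sup>2 + (y $ 2 / r)\<^sup>2 = r\<^sup>2 / r\<^sup>2"
    by (simp add: c_def power_divide add_divide_distrib[symmetric] r2[symmetric])
  then have c2: "1 - c\<^sup>2 = (y $ 2 / r)\<^sup>2" using r by simp
  then have "c\<^sup>2 < 1" using y r by (smt (verit) divide_pos_pos zero_less_power)
  then have c: "- 1 < c" "c < 1" by (auto simp: abs_square_less_1 abs_less_iff)
  have "sin (arccos c) = y $ 2 / r"
    using c c2 y r by (simp add: sin_arccos)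
  moreover have "cos (arccos c) = y $ 1 / r" using c by (simp add: c_def)
  moreover have "0 < arccos c" "arccos c < pi" using arccos_lt_bounded[of c] c by auto
  ultimately show "y \<in> ?g ` ?S"
    using r by (intro image_eqI[of _ _ "vec2 r (arccos c)"]) (auto simp: vec_eq_iff forall_2)
qed (auto simp: sin_gt_zero)

text \<open>The norm of the image recovers the radius, and \<open>cos\<close> is injective between 0
  and \<open>pi\<close>, which recovers the angle.\<close>

lemma polar_inj:
  "inj_on (\<lambda>x::real^2. vec2 (x $ 1 * cos (x $ 2)) (x $ 1 * sin (x $ 2))) {x. 0 < x $ 1 \<and> 0 < x $ 2 \<and> x $ 2 < pi}"
    (is "inj_on ?g ?S")
proof (rule inj_onI)
  fix x y assume xy: "x \<in> ?S" "y \<in> ?S" and eq: "?g x = ?g y"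
  have g: "(norm (?g z))\<^sup>2 = (z $ 1)\<^sup>2" for z
    by (simp add: norm_real2_power2 power_mult_distrib flip: distrib_left)
  have 1: "x $ 1 = y $ 1"
    using g[of x] g[of y] eq xy by (auto intro: power2_eq_imp_eq)
  have "x $ 1 * cos (x $ 2) = y $ 1 * cos (y $ 2)"
    using arg_cong[OF eq, of "\<lambda>v. v $ 1"] by simp
  then have "cos (x $ 2) = cos (y $ 2)" using 1 xy by simp
  then have "x $ 2 = y $ 2" using xy cos_inj_pi[of "x $ 2" "y $ 2"] by simp
  with 1 show "x = y" by (simp add: vec_eq_iff forall_2)
qed

text \<open>The coordinates 1 and 2 of a point of the strip \<open>?S\<close> are radius and angle,
  and the Jacobian is the radius. After the change of variables the strip is moved to pairs, where
  Fubini gives the iterated integral.\<close>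

lemma polar_upper_half_plane:
  fixes f :: "real ^ 2 \<Rightarrow> real"
  assumes f: "integrable lborel f"
  shows "(LINT x:{x. 0 < x $ 2}|lborel. f x) =
    (LBINT r=0..\<infinity>. (LBINT \<theta>=0..ereal pi. r * f (vec2 (r * cos \<theta>) (r * sin \<theta>))))"
proof -
  let ?g = "\<lambda>x::real^2. vec2 (x $ 1 * cos (x $ 2)) (x $ 1 * sin (x $ 2))"
  let ?S = "{x::real^2. 0 < x $ 1 \<and> 0 < x $ 2 \<and> x $ 2 < pi}"
  let ?H = "{x::real^2. 0 < x $ 2}"
  \<comment> \<open>The derivative of the polar map at \<open>x\<close>, applied to
    \<open>v\<close>.\<close>
  define g' where "g' x v = vec2 (v $ 1 * cos (x $ 2) - x $ 1 * sin (x $ 2) * v $ 2)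
      (v $ 1 * sin (x $ 2) + x $ 1 * cos (x $ 2) * v $ 2)" for x v :: "real ^ 2"
  have f_meas[measurable]: "f \<in> borel_measurable borel" using f by (simp add: borel_measurable_integrable measurable_lborel1)
  have S[measurable]: "?S \<in> sets borel" and H[measurable]: "?H \<in> sets borel"
    by (auto intro!: borel_open open_Collect_less open_Collect_conj continuous_intros)
  have vec2_borel: "(\<lambda>x. vec2 (u x) (v x)) \<in> borel_measurable M"
    if "u \<in> borel_measurable M" "v \<in> borel_measurable M" for u v and M :: "'x measure"
    using that by (subst borel_measurable_euclidean_space) (auto simp: Basis_vec_def inner_axis exhaust_2 forall_2)
  have comp_meas[measurable]: "(\<lambda>x. x $ i) \<in> borel_measurable borel" for i :: 2
    by (intro borel_measurable_continuous_onI continuous_intros)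
  have [measurable]: "?g \<in> borel_measurable borel" by (intro vec2_borel) measurable
  have det: "\<bar>det (matrix (g' x))\<bar> = x $ 1" if "x \<in> ?S" for x
  proof -
    have "det (matrix (g' x)) = cos (x $ 2) * (x $ 1 * cos (x $ 2)) + x $ 1 * sin (x $ 2) * sin (x $ 2)"
      unfolding det_2 matrix_def g'_def by (simp add: axis_def)
    also have "\<dots> = x $ 1 * ((cos (x $ 2))\<^sup>2 + (sin (x $ 2))\<^sup>2)"
      by (simp only: power2_eq_square algebra_simps)
    finally have "det (matrix (g' x)) = x $ 1 * ((cos (x $ 2))\<^sup>2 + (sin (x $ 2))\<^sup>2)" .
    with that show ?thesis by simp
  qed
  have der: "(?g has_derivative g' x) (at x within ?S)" for x
  proof -
    have "((\<lambda>x. ?g x $ i) has_derivative (\<lambda>v. g' x v $ i)) (at x within ?S)" for i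
    proof (cases "i = 1")
      case True
      then show ?thesis unfolding g'_def
        by (auto intro!: derivative_eq_intros bounded_linear.has_derivative[OF bounded_linear_vec_nth] simp: fun_eq_iff)
    next
      case False
      then have "i = 2" using exhaust_2 by blast
      then show ?thesis unfolding g'_def
        by (auto intro!: derivative_eq_intros bounded_linear.has_derivative[OF bounded_linear_vec_nth] simp: fun_eq_iff)
    qed
    then show ?thesis
      by (subst has_derivative_componentwise_within) (auto simp: Basis_vec_def inner_axis)
  qed
  have fH: "set_integrable lborel ?H f"
    unfolding set_integrable_def by (intro integrable_mult_indicator f) simp
  have absH: "f absolutely_integrable_on ?H"
    using fH unfolding set_integrable_def by (subst integrable_completion) auto
  have eqv: "(\<lambda>x. x $ 1 * f (?g x)) absolutely_integrable_on ?S \<and>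
      integral ?S (\<lambda>x. x $ 1 * f (?g x)) = integral ?H f"
  proof -
    \<comment> \<open>The change of variables theorem is stated for vector-valued functions, so
      \<open>f\<close> passes through \<open>real ^ 1\<close>.\<close>
    have "(\<lambda>x. \<bar>det (matrix (g' x))\<bar> *\<^sub>R (vec (f (?g x)) :: real ^ 1)) absolutely_integrable_on ?S \<and>
        integral ?S (\<lambda>x. \<bar>det (matrix (g' x))\<bar> *\<^sub>R (vec (f (?g x)) :: real ^ 1)) = vec (integral ?H f)"
      using absH polar_image
      by (subst has_absolute_integral_change_of_variables[OF _ der polar_inj, of "\<lambda>x. vec (f x)"])
        (auto simp: absolutely_integrable_on_1_iff integral_on_1_eq)
    then have "(\<lambda>x. \<bar>det (matrix (g' x))\<bar> * f (?g x)) absolutely_integrable_on ?S \<and>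
        integral ?S (\<lambda>x. \<bar>det (matrix (g' x))\<bar> * f (?g x)) = integral ?H f"
      by (simp add: absolutely_integrable_on_1_iff integral_on_1_eq)
    moreover have "(\<lambda>x. \<bar>det (matrix (g' x))\<bar> * f (?g x)) absolutely_integrable_on ?S \<longleftrightarrow>
        (\<lambda>x. x $ 1 * f (?g x)) absolutely_integrable_on ?S"
      by (intro set_integrable_cong refl) (simp only: det)
    moreover have "integral ?S (\<lambda>x. \<bar>det (matrix (g' x))\<bar> * f (?g x)) = integral ?S (\<lambda>x. x $ 1 * f (?g x))"
      by (intro Henstock_Kurzweil_Integration.integral_cong) (simp only: det)
    ultimately show ?thesis by simp
  qed
  let ?F = "\<lambda>x. x $ 1 * f (?g x)"
  have intS: "set_integrable lborel ?S ?F"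
    using eqv unfolding set_integrable_def by (subst (asm) integrable_completion) auto
  \<comment> \<open>The indicator of the strip is split into one factor per variable, so that fixing
    the radius leaves exactly the inner interval integral.\<close>
  define G where "G z = indicator {0<..} (fst z) *\<^sub>R (indicator {0<..<pi} (snd z) *\<^sub>R
      (fst z * f (vec2 (fst z * cos (snd z)) (fst z * sin (snd z)))))" for z :: "real \<times> real"
  have m: "(\<lambda>(x, y). vec2 x y) \<in> borel_measurable (lborel :: (real \<times> real) measure)"
    unfolding case_prod_unfold by (intro vec2_borel) (auto simp: borel_prod[symmetric])
  have m': "(\<lambda>x. indicator ?S x *\<^sub>R ?F x) \<in> borel_measurable borel" by measurable
  have pt: "indicator ?S (case z of (x, y) \<Rightarrow> vec2 x y) *\<^sub>R ?F (case z of (x, y) \<Rightarrow> vec2 x y) = G z" for z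
    by (cases z) (auto simp: indicator_def G_def)
  have G: "integrable (lborel \<Otimes>\<^sub>M lborel) G"
    using intS unfolding set_integrable_def lborel_prod
    by (subst (asm) lborel_vec2[symmetric], subst (asm) integrable_distr_eq[OF m m']) (simp only: pt)
  have "(LINT x:?H|lborel. f x) = (LINT x:?S|lborel. ?F x)"
    using set_borel_integral_eq_integral(2)[OF fH] set_borel_integral_eq_integral(2)[OF intS] eqv by simp
  also have "\<dots> = (\<integral>z. G z \<partial>(lborel \<Otimes>\<^sub>M lborel))"
    unfolding set_lebesgue_integral_def lborel_prod
    by (subst lborel_vec2[symmetric], subst integral_distr[OF m m']) (simp only: pt)
  also have "\<dots> = (\<integral>r. (\<integral>\<theta>. G (r, \<theta>) \<partial>lborel) \<partial>lborel)"
    by (rule lborel_pair.integral_fst'[OF G, symmetric])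
  also have "\<dots> = (LBINT r=0..\<infinity>. (LBINT \<theta>=0..ereal pi. r * f (vec2 (r * cos \<theta>) (r * sin \<theta>))))"
  proof -
    have "einterval 0 \<infinity> = {0<..}" "einterval 0 (ereal pi) = {0<..<pi}"
      by (auto simp: einterval_def)
    then have I: "(LBINT r=0..\<infinity>. h r) = (\<integral>r. indicator {0<..} r *\<^sub>R h r \<partial>lborel)"
        "(LBINT \<theta>=0..ereal pi. h \<theta>) = (\<integral>\<theta>. indicator {0<..<pi} \<theta> *\<^sub>R h \<theta> \<partial>lborel)" for h :: "real \<Rightarrow> real"
      by (simp_all only: interval_lebesgue_integral_def set_lebesgue_integral_def) simp_all
    show ?thesis
      unfolding I G_def by (simp only: fst_conv snd_conv integral_scaleR_right)
  qed
  finally show ?thesis .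
qed

text \<open>The first axis is a null set, and the reflection in it preserves Lebesgue measure,
  preserves \<open>f\<close> and exchanges the two half planes.\<close>

lemma polar_symmetric:
  fixes f :: "real ^ 2 \<Rightarrow> real"
  assumes f: "integrable lborel f" and sym: "\<And>x. f (vec2 (x $ 1) (- x $ 2)) = f x"
  shows "(\<integral>x. f x \<partial>lborel) =
    2 * (LBINT r=0..\<infinity>. (LBINT \<theta>=0..ereal pi. r * f (vec2 (r * cos \<theta>) (r * sin \<theta>))))"
proof -
  let ?R = "\<lambda>x::real^2. vec2 (x $ 1) (- x $ 2)"
  let ?H = "{x::real^2. 0 < x $ 2}" and ?L = "{x::real^2. x $ 2 < 0}"
  have f_meas[measurable]: "f \<in> borel_measurable borel" using f by (simp add: borel_measurable_integrable measurable_lborel1)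
  have H[measurable]: "?H \<in> sets borel" and L[measurable]: "?L \<in> sets borel"
    by (auto intro!: borel_open open_Collect_less continuous_intros)
  have R: "distr lborel borel ?R = lborel"
  proof (rule lborel_distr_linear_isometry)
    show "linear ?R" by (rule linearI) (auto simp: vec_eq_iff forall_2)
    show "norm (?R z) = norm z" for z
      by (rule power2_eq_imp_eq) (auto simp: norm_real2_power2)
    show "surj ?R" by (rule surjI[of _ ?R]) (simp add: vec_eq_iff forall_2)
  qed simp
  have [measurable]: "?R \<in> borel_measurable borel"
    by (subst borel_measurable_euclidean_space) (auto simp: Basis_vec_def inner_axis forall_2
        intro!: borel_measurable_continuous_onI continuous_intros)
  have "negligible {x::real^2. x $ 2 = 0}" by (rule negligible_standard_hyperplane_cart)
  then have "AE x in lebesgue. x \<notin> {x::real^2. x $ 2 = 0}"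
    unfolding negligible_iff_null_sets by (rule AE_not_in)
  then have ae: "AE x in lborel. (x::real^2) $ 2 \<noteq> 0" by (simp add: AE_completion_iff)
  have "(\<integral>x. f x \<partial>lborel) = (\<integral>x. indicator ?H x * f x + indicator ?L x * f x \<partial>lborel)"
    using ae by (intro integral_cong_AE) (auto elim!: eventually_mono split: split_indicator)
  also have "\<dots> = (\<integral>x. indicator ?H x * f x \<partial>lborel) + (\<integral>x. indicator ?L x * f x \<partial>lborel)"
    using integrable_mult_indicator[OF _ f, of ?H] integrable_mult_indicator[OF _ f, of ?L]
    by (intro Bochner_Integration.integral_add) auto
  also have "(\<integral>x. indicator ?L x * f x \<partial>lborel) = (\<integral>x. indicator ?H x * f x \<partial>lborel)"
  proof -
    have "(\<integral>x. indicator ?L x * f x \<partial>lborel) = (\<integral>x. indicator ?L (?R x) * f (?R x) \<partial>lborel)"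
      by (subst R[symmetric], subst integral_distr) auto
    also have "\<dots> = (\<integral>x. indicator ?H x * f x \<partial>lborel)"
      by (intro Bochner_Integration.integral_cong refl) (auto simp: sym indicator_def)
    finally show ?thesis .
  qed
  also have "(\<integral>x. indicator ?H x * f x \<partial>lborel) = (LINT x:?H|lborel. f x)"
    by (simp add: set_lebesgue_integral_def)
  finally show ?thesis by (simp add: polar_upper_half_plane[OF f])
qed

section \<open>Conditioning on independent channels\<close>

text \<open>The factors all depend on \<open>Y None\<close> and are not independent. For a fixed
  value \<open>v\<close> of it they are, and \<open>c\<close> says that their means do not see
  \<open>v\<close>, so the outer integral is over a constant. In the application
  \<open>Y None\<close> holds the source-to-relay coefficients.\<close>

lemma (in prob_space) nn_integral_indep_common_factor:
  fixes Y :: "nat option \<Rightarrow> 'a \<Rightarrow> 'b"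
  assumes indep: "indep_vars N Y UNIV"
    and h[measurable]: "\<And>i. h i \<in> borel_measurable (N None \<Otimes>\<^sub>M N (Some i))"
    and c: "\<And>i v. v \<in> space (N None) \<Longrightarrow> (\<integral>\<^sup>+\<omega>. h i (v, Y (Some i) \<omega>) \<partial>M) = c i"
  shows "(\<integral>\<^sup>+\<omega>. (\<Prod>i<m. h i (Y None \<omega>, Y (Some i) \<omega>)) \<partial>M) = (\<Prod>i<m. c i)"
proof -
  let ?I = "Some ` {..<m}"
  have Y[measurable]: "Y j \<in> measurable M (N j)" for j using indep unfolding indep_vars_def by auto
  define \<mu> where "\<mu> j = distr M (N j) (Y j)" for j
  have sets_\<mu>[simp, measurable_cong]: "sets (\<mu> j) = sets (N j)" for j by (simp add: \<mu>_def)
  have prob_\<mu>: "prob_space (\<mu> j)" for j unfolding \<mu>_def by (rule prob_space_distr) simp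
  interpret \<mu>: product_sigma_finite \<mu>
    by (rule product_sigma_finite.intro) (intro prob_space_imp_sigma_finite prob_\<mu>)
  have D: "distr M (Pi\<^sub>M (insert None ?I) N) (\<lambda>\<omega>. \<lambda>j\<in>insert None ?I. Y j \<omega>) = Pi\<^sub>M (insert None ?I) \<mu>"
    unfolding \<mu>_def using indep_vars_subset[OF indep, of "insert None ?I"]
    by (subst indep_vars_iff_distr_eq_PiM'[symmetric]) auto
  have f: "(\<lambda>y. \<Prod>i<m. h i (y None, y (Some i))) \<in> borel_measurable (Pi\<^sub>M (insert None ?I) N)"
    by measurable
  then have f': "(\<lambda>y. \<Prod>i<m. h i (y None, y (Some i))) \<in> borel_measurable (Pi\<^sub>M (insert None ?I) \<mu>)"
    by (simp cong: measurable_cong_sets sets_PiM_cong)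
  have "(\<integral>\<^sup>+\<omega>. (\<Prod>i<m. h i (Y None \<omega>, Y (Some i) \<omega>)) \<partial>M) =
      (\<integral>\<^sup>+y. (\<Prod>i<m. h i (y None, y (Some i))) \<partial>Pi\<^sub>M (insert None ?I) \<mu>)"
    unfolding D[symmetric] by (subst nn_integral_distr) (use f in auto)
  \<comment> \<open>The shared coordinate becomes the outermost variable.\<close>
  also have "\<dots> = (\<integral>\<^sup>+v. (\<integral>\<^sup>+y. (\<Prod>i<m. h i (v, y (Some i))) \<partial>Pi\<^sub>M ?I \<mu>) \<partial>\<mu> None)"
    by (subst \<mu>.product_nn_integral_insert_rev[OF _ _ f']) auto
  also have "\<dots> = (\<integral>\<^sup>+v. (\<Prod>i<m. c i) \<partial>\<mu> None)"
  proof (intro nn_integral_cong)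
    fix v assume v: "v \<in> space (\<mu> None)"
    then have v': "v \<in> space (N None)" by (simp add: \<mu>_def)
    have "(\<integral>\<^sup>+y. (\<Prod>i<m. h i (v, y (Some i))) \<partial>Pi\<^sub>M ?I \<mu>) = (\<integral>\<^sup>+y. (\<Prod>j\<in>?I. h (the j) (v, y j)) \<partial>Pi\<^sub>M ?I \<mu>)"
      by (simp add: prod.reindex)
    also have "\<dots> = (\<Prod>j\<in>?I. \<integral>\<^sup>+y. h (the j) (v, y) \<partial>\<mu> j)"
      using v' by (intro \<mu>.product_nn_integral_prod) auto
    also have "\<dots> = (\<Prod>i<m. \<integral>\<^sup>+y. h i (v, y) \<partial>\<mu> (Some i))"
      by (simp add: prod.reindex)
    also have "\<dots> = (\<Prod>i<m. c i)"
      using v' by (intro prod.cong refl) (simp add: \<mu>_def nn_integral_distr c)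
    finally show "(\<integral>\<^sup>+y. (\<Prod>i<m. h i (v, y (Some i))) \<partial>Pi\<^sub>M ?I \<mu>) = (\<Prod>i<m. c i)" .
  qed
  also have "\<dots> = (\<Prod>i<m. c i)" using prob_space.emeasure_space_1[OF prob_\<mu>] by simp
  finally show ?thesis .
qed

text \<open>The joint law is the product of the two laws, since they agree on rectangles; then
  Fubini applies. It allows the locations to be frozen while the channels are averaged.\<close>

lemma (in prob_space) nn_integral_indep_elements:
  assumes ind: "indep_elements M S X T Y" and f: "f \<in> borel_measurable (S \<Otimes>\<^sub>M T)"
  shows "(\<integral>\<^sup>+\<omega>. f (X \<omega>, Y \<omega>) \<partial>M) = (\<integral>\<^sup>+\<omega>. (\<integral>\<^sup>+\<omega>'. f (X \<omega>, Y \<omega>') \<partial>M) \<partial>M)"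
proof -
  have [measurable]: "X \<in> measurable M S" "Y \<in> measurable M T"
    using ind by (auto simp: indep_elements_def)
  note f[measurable]
  interpret DX: prob_space "distr M S X" by (rule prob_space_distr) simp
  interpret DY: prob_space "distr M T Y" by (rule prob_space_distr) simp
  have D: "distr M S X \<Otimes>\<^sub>M distr M T Y = distr M (S \<Otimes>\<^sub>M T) (\<lambda>\<omega>. (X \<omega>, Y \<omega>))"
  proof (rule pair_measure_eqI)
    fix A B assume A: "A \<in> sets (distr M S X)" and B: "B \<in> sets (distr M T Y)"
    have "prob ((X -` A \<inter> space M) \<inter> (Y -` B \<inter> space M)) = prob (X -` A \<inter> space M) * prob (Y -` B \<inter> space M)"
      using ind A B unfolding indep_elements_def by (intro indep_setD) auto
    moreover have "(X -` A \<inter> space M) \<inter> (Y -` B \<inter> space M) = (\<lambda>\<omega>. (X \<omega>, Y \<omega>)) -` (A \<times> B) \<inter> space M" by auto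
    ultimately show "emeasure (distr M S X) A * emeasure (distr M T Y) B =
        emeasure (distr M (S \<Otimes>\<^sub>M T) (\<lambda>\<omega>. (X \<omega>, Y \<omega>))) (A \<times> B)"
      using A B by (simp add: emeasure_distr emeasure_eq_measure ennreal_mult'[symmetric])
  qed (auto intro: DX.sigma_finite_measure_axioms DY.sigma_finite_measure_axioms cong: sets_pair_measure_cong)
  have "(\<integral>\<^sup>+\<omega>. f (X \<omega>, Y \<omega>) \<partial>M) = (\<integral>\<^sup>+z. f z \<partial>(distr M S X \<Otimes>\<^sub>M distr M T Y))"
    by (simp add: D nn_integral_distr)
  also have "\<dots> = (\<integral>\<^sup>+x. (\<integral>\<^sup>+y. f (x, y) \<partial>distr M T Y) \<partial>distr M S X)"
    by (subst DY.nn_integral_fst[symmetric]) (simp_all cong: measurable_cong_sets sets_pair_measure_cong)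
  also have "\<dots> = (\<integral>\<^sup>+x. (\<integral>\<^sup>+\<omega>'. f (x, Y \<omega>') \<partial>M) \<partial>distr M S X)"
    by (intro nn_integral_cong) (simp add: nn_integral_distr)
  also have "\<dots> = (\<integral>\<^sup>+\<omega>. (\<integral>\<^sup>+\<omega>'. f (X \<omega>, Y \<omega>') \<partial>M) \<partial>M)"
    by (subst nn_integral_distr) simp_all
  finally show ?thesis .
qed

text \<open>The coefficients of one eavesdropper sit inside a family indexed by all channels;
  \<open>f\<close> picks the antenna entries, later as \<open>SE i\<close>.\<close>

lemma emeasure_cgauss_vec_reindex:
  fixes f :: "'n::finite \<Rightarrow> 'c"
  assumes f: "inj f" and A[measurable]: "A \<in> sets borel"
  shows "(\<integral>\<^sup>+x. indicator A (\<chi> k. x (f k)) \<partial>Pi\<^sub>M (range f) (\<lambda>_. cgauss)) = emeasure cgauss_vec A"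
proof -
  have m: "vec_lambda \<in> measurable (Pi\<^sub>M UNIV (\<lambda>_::'n. cgauss)) borel"
    using measurable_vec_lambda by (simp cong: measurable_cong_sets sets_PiM_cong)
  have D: "distr (Pi\<^sub>M (range f) (\<lambda>_. cgauss)) (Pi\<^sub>M UNIV (\<lambda>_. cgauss)) (\<lambda>\<omega>. \<lambda>n\<in>UNIV. \<omega> (f n)) =
      Pi\<^sub>M UNIV (\<lambda>_. cgauss)"
    using f by (intro distr_PiM_reindex prob_space_cgauss) auto
  have "emeasure cgauss_vec A = (\<integral>\<^sup>+x. indicator A x \<partial>cgauss_vec)"
    by (simp add: cgauss_vec_def)
  also have "\<dots> = (\<integral>\<^sup>+z. indicator A (vec_lambda z) \<partial>Pi\<^sub>M UNIV (\<lambda>_. cgauss))"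
    unfolding cgauss_vec_def by (subst nn_integral_distr[OF m]) simp_all
  also have "\<dots> = (\<integral>\<^sup>+x. indicator A (\<chi> k. x (f k)) \<partial>Pi\<^sub>M (range f) (\<lambda>_. cgauss))"
  proof -
    have "(\<lambda>\<omega>. \<lambda>n\<in>UNIV. \<omega> (f n)) \<in> measurable (Pi\<^sub>M (range f) (\<lambda>_. cgauss)) (Pi\<^sub>M UNIV (\<lambda>_. cgauss))"
      by (intro measurable_restrict measurable_component_singleton) simp
    then show ?thesis
      by (subst D[symmetric], subst nn_integral_distr) (use m in \<open>auto simp: restrict_UNIV\<close>)
  qed
  finally show ?thesis by simp
qed

text \<open>For one eavesdropper, with \<open>f = SE i\<close> and \<open>r = RE i\<close>, the
  events of the two time slots concern disjoint sets of coefficients, so their probabilities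
  multiply.\<close>

lemma (in prob_space) nn_integral_indep_cgauss_vec:
  fixes C :: "'c \<Rightarrow> 'a \<Rightarrow> complex" and f :: "'n::finite \<Rightarrow> 'c"
  assumes indep: "indep_vars (\<lambda>_. borel) C UNIV" and C: "\<And>c. distr M borel (C c) = cgauss"
    and f: "inj f" "r \<notin> range f" and A[measurable]: "A \<in> sets borel" and B[measurable]: "B \<in> sets borel"
  shows "(\<integral>\<^sup>+\<omega>. indicator A (\<chi> k. C (f k) \<omega>) * indicator B (C r \<omega>) \<partial>M) = emeasure cgauss_vec A * emeasure cgauss B"
proof -
  interpret G: prob_space cgauss by (rule prob_space_cgauss)
  interpret P: product_sigma_finite "\<lambda>_::'c. cgauss" ..
  let ?J = "insert r (range f)"
  have C_meas[measurable]: "C c \<in> borel_measurable M" for c using indep unfolding indep_vars_def by auto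
  have D: "distr M (Pi\<^sub>M ?J (\<lambda>_. borel)) (\<lambda>\<omega>. \<lambda>j\<in>?J. C j \<omega>) = Pi\<^sub>M ?J (\<lambda>_. cgauss)"
    using indep_vars_subset[OF indep, of ?J] indep_vars_iff_distr_eq_PiM'[of ?J C "\<lambda>_. borel"] by (simp add: C)
  have vec: "(\<lambda>y. \<chi> k. y (f k)) \<in> borel_measurable (Pi\<^sub>M J (\<lambda>_. borel :: complex measure))" if "range f \<subseteq> J" for J
    using that by (intro measurable_compose[OF _ measurable_vec_lambda] measurable_PiM_single' measurable_component_singleton) auto
  have [measurable]: "(\<lambda>y. \<chi> k. y (f k)) \<in> borel_measurable (Pi\<^sub>M ?J (\<lambda>_. borel :: complex measure))"
    "(\<lambda>y. \<chi> k. y (f k)) \<in> borel_measurable (Pi\<^sub>M (range f) (\<lambda>_. borel :: complex measure))"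
    by (auto intro!: vec)
  let ?h = "\<lambda>y. indicator A (\<chi> k. y (f k)) * indicator B (y r) :: ennreal"
  have h: "?h \<in> borel_measurable (Pi\<^sub>M ?J (\<lambda>_. borel))" by measurable
  then have h': "?h \<in> borel_measurable (Pi\<^sub>M ?J (\<lambda>_. cgauss))"
    by (simp cong: measurable_cong_sets sets_PiM_cong)
  have "(\<integral>\<^sup>+\<omega>. indicator A (\<chi> k. C (f k) \<omega>) * indicator B (C r \<omega>) \<partial>M) = (\<integral>\<^sup>+y. ?h y \<partial>Pi\<^sub>M ?J (\<lambda>_. cgauss))"
    unfolding D[symmetric] by (subst nn_integral_distr) (use h in auto)
  also have "\<dots> = (\<integral>\<^sup>+x. (\<integral>\<^sup>+y. ?h (x(r := y)) \<partial>cgauss) \<partial>Pi\<^sub>M (range f) (\<lambda>_. cgauss))"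
    using f by (intro P.product_nn_integral_insert h') auto
  also have "\<dots> = (\<integral>\<^sup>+x. indicator A (\<chi> k. x (f k)) * emeasure cgauss B \<partial>Pi\<^sub>M (range f) (\<lambda>_. cgauss))"
  proof (intro nn_integral_cong)
    fix x :: "'c \<Rightarrow> complex"
    have "f k \<noteq> r" for k using f by auto
    then show "(\<integral>\<^sup>+y. ?h (x(r := y)) \<partial>cgauss) = indicator A (\<chi> k. x (f k)) * emeasure cgauss B"
      by (simp add: nn_integral_cmult)
  qed
  also have "\<dots> = (\<integral>\<^sup>+x. indicator A (\<chi> k. x (f k)) \<partial>Pi\<^sub>M (range f) (\<lambda>_. cgauss)) * emeasure cgauss B"
    by (intro nn_integral_multc) (simp cong: measurable_cong_sets sets_PiM_cong)
  finally show ?thesis by (simp add: emeasure_cgauss_vec_reindex[OF f(1)])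
qed

section \<open>Outage probability at a location and its integral\<close>

lemma borel_measurable_vec_nth[measurable (raw)]:
  fixes f :: "'x \<Rightarrow> 'a::euclidean_space ^ 'n::finite"
  assumes "f \<in> borel_measurable M"
  shows "(\<lambda>x. f x $ i) \<in> borel_measurable M"
  using assms by (rule measurable_compose)
    (intro borel_measurable_continuous_onI continuous_intros)

lemma measurable_snr_source[measurable (raw)]:
  fixes w h :: "'x \<Rightarrow> complex ^ 'n" and A :: "'x \<Rightarrow> complex ^ 'm ^ 'n"
  assumes [measurable]: "w \<in> borel_measurable M" "A \<in> borel_measurable M" "d \<in> borel_measurable M" "h \<in> borel_measurable M"
  shows "(\<lambda>x. snr_source \<beta> Ps \<eta> v1 (w x) (A x) (d x) (h x)) \<in> borel_measurable M"
  unfolding snr_source_def an_power_eq_norm norm_vec_power2 scalar_product_def vector_matrix_mult_def vec_lambda_beta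
  by measurable

lemma measurable_snr_relay[measurable (raw)]:
  assumes [measurable]: "d \<in> borel_measurable M" "h \<in> borel_measurable M"
  shows "(\<lambda>x. snr_relay Pr \<eta> v2 (d x) (h x)) \<in> borel_measurable M"
  unfolding snr_relay_def by measurable

text \<open>The factors \<open>x \<noteq> 0\<close> and \<open>x \<noteq> relay\<close> account for \<open>0 powr \<eta> = 0\<close>: the formalised SNRs vanish at distance \<open>0\<close>.\<close>
definition source_outage :: "nat \<Rightarrow> real \<Rightarrow> real \<Rightarrow> real \<Rightarrow> real \<Rightarrow> real \<Rightarrow> real ^ 2 \<Rightarrow> real" where
  "source_outage N \<beta> \<eta> Ps v1 \<tau> x =
     (if x = 0 then 0 else an_factor N \<beta> \<tau> * exp (- (\<tau> * v1 / (\<beta> * Ps) * norm x powr \<eta>)))"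

definition relay_outage :: "real \<Rightarrow> real \<Rightarrow> real \<Rightarrow> real \<Rightarrow> real ^ 2 \<Rightarrow> real ^ 2 \<Rightarrow> real" where
  "relay_outage \<eta> Pr v2 \<tau> y x =
     (if x = y then 0 else exp (- (\<tau> * v2 / Pr * norm (x - y) powr \<eta>)))"

text \<open>The complement of no outage in either slot, whose probabilities multiply at a fixed
  location. Expanding the product gives the three terms behind \<open>J1\<close>, \<open>J2\<close>
  and \<open>J3\<close>.\<close>

definition outage :: "nat \<Rightarrow> real \<Rightarrow> real \<Rightarrow> real \<Rightarrow> real \<Rightarrow> real \<Rightarrow> real \<Rightarrow> real \<Rightarrow> real ^ 2 \<Rightarrow> real ^ 2 \<Rightarrow> real" where
  "outage N \<beta> \<eta> Ps Pr v1 v2 \<tau> y x =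
     1 - (1 - source_outage N \<beta> \<eta> Ps v1 \<tau> x) * (1 - relay_outage \<eta> Pr v2 \<tau> y x)"

lemma an_factor_bounds:
  assumes "2 \<le> N" "0 < \<beta>" "\<beta> \<le> 1" "0 < \<tau>"
  shows "0 \<le> an_factor N \<beta> \<tau>" "an_factor N \<beta> \<tau> \<le> 1"
proof -
  have "0 \<le> (1 - \<beta>) * \<tau> / (\<beta> * (real N - 1))" using assms by auto
  then have "an_factor N \<beta> \<tau> \<le> (1 + (1 - \<beta>) * \<tau> / (\<beta> * (real N - 1))) powr 0"
    unfolding an_factor_def using assms by (intro powr_mono) auto
  then show "an_factor N \<beta> \<tau> \<le> 1" by (rule order_trans) simp
qed (simp add: an_factor_def)

lemma source_outage_bounds:
  assumes "2 \<le> N" "0 < \<beta>" "\<beta> \<le> 1" "0 < \<tau>" "0 < Ps" "0 < v1"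
  shows "0 \<le> source_outage N \<beta> \<eta> Ps v1 \<tau> x" "source_outage N \<beta> \<eta> Ps v1 \<tau> x \<le> 1"
  using an_factor_bounds[OF assms(1-4)] assms by (auto simp: source_outage_def intro!: mult_le_one)

lemma relay_outage_bounds:
  assumes "0 < \<tau>" "0 < Pr" "0 < v2"
  shows "0 \<le> relay_outage \<eta> Pr v2 \<tau> y x" "relay_outage \<eta> Pr v2 \<tau> y x \<le> 1"
  using assms by (auto simp: relay_outage_def)

lemma outage_bounds:
  assumes "2 \<le> N" "0 < \<beta>" "\<beta> \<le> 1" "0 < \<tau>" "0 < Ps" "0 < v1" "0 < Pr" "0 < v2"
  shows "0 \<le> outage N \<beta> \<eta> Ps Pr v1 v2 \<tau> y x" "outage N \<beta> \<eta> Ps Pr v1 v2 \<tau> y x \<le> 1"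
  using source_outage_bounds[OF assms(1-6), of \<eta> x] relay_outage_bounds[OF assms(4,7,8), of \<eta> y x]
  by (auto simp: outage_def mult_le_one)

lemma (in prob_space) emeasure_compl_event:
  assumes "{x \<in> space M. P x} \<in> sets M" and "emeasure M {x \<in> space M. P x} = ennreal p" and "0 \<le> p"
  shows "emeasure M {x \<in> space M. \<not> P x} = ennreal (1 - p)"
proof -
  have "{x \<in> space M. \<not> P x} = space M - {x \<in> space M. P x}" by auto
  moreover have "prob {x \<in> space M. P x} = p" using assms by (simp add: emeasure_eq_measure)
  ultimately show ?thesis using assms(1) by (simp add: emeasure_eq_measure prob_compl)
qed

lemma prob_space_cgauss_vec: "prob_space (cgauss_vec :: (complex ^ 'n::finite) measure)"
proof -
  have m: "vec_lambda \<in> measurable (Pi\<^sub>M UNIV (\<lambda>_::'n. cgauss)) borel"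
    using measurable_vec_lambda by (simp cong: measurable_cong_sets sets_PiM_cong)
  show "prob_space (cgauss_vec :: (complex ^ 'n) measure)" unfolding cgauss_vec_def
    by (rule prob_space.prob_space_distr[OF prob_space_PiM[OF prob_space_cgauss] m])
qed

lemma source_no_outage:
  fixes w :: "complex ^ 'n" and A :: "complex ^ 'm ^ 'n"
  assumes "unitary_matrix (beam_matrix w A)" "2 \<le> N" "CARD('n) = N" "CARD('m) = N - 1"
    and pos: "0 < \<beta>" "\<beta> \<le> 1" "0 < Ps" "0 < v1" "0 < \<tau>"
  shows "emeasure cgauss_vec {h. \<not> \<tau> < snr_source \<beta> Ps \<eta> v1 w A (norm x) h} =
    ennreal (1 - source_outage N \<beta> \<eta> Ps v1 \<tau> x)"
proof -
  interpret prob_space "cgauss_vec :: (complex ^ 'n) measure" by (rule prob_space_cgauss_vec)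
  have sp: "space (cgauss_vec :: (complex ^ 'n) measure) = UNIV" by (simp add: cgauss_vec_def)
  have "emeasure cgauss_vec {h. \<tau> < snr_source \<beta> Ps \<eta> v1 w A (norm x) h} = ennreal (source_outage N \<beta> \<eta> Ps v1 \<tau> x)"
  proof (cases "x = 0")
    case True
    then show ?thesis using pos by (simp add: snr_source_def source_outage_def)
  next
    case False
    then show ?thesis using snr_source_outage[OF assms(1-4) pos, of "norm x"] by (simp add: source_outage_def)
  qed
  moreover have "{h. \<tau> < snr_source \<beta> Ps \<eta> v1 w A (norm x) h} \<in> sets cgauss_vec"
  proof -
    have "{h \<in> space borel. \<tau> < snr_source \<beta> Ps \<eta> v1 w A (norm x) h} \<in> sets borel" by measurable
    then show ?thesis by (simp add: cgauss_vec_def)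
  qed
  ultimately show ?thesis
    using emeasure_compl_event[of "\<lambda>h. \<tau> < snr_source \<beta> Ps \<eta> v1 w A (norm x) h"] source_outage_bounds[of N \<beta> \<tau> Ps v1 \<eta> x] assms
    by (simp add: sp)
qed

lemma relay_no_outage:
  assumes pos: "0 < Pr" "0 < v2" "0 < \<tau>"
  shows "emeasure cgauss {z. \<not> \<tau> < snr_relay Pr \<eta> v2 (dist x y) z} = ennreal (1 - relay_outage \<eta> Pr v2 \<tau> y x)"
proof -
  interpret prob_space cgauss by (rule prob_space_cgauss)
  have "emeasure cgauss {z. \<tau> < snr_relay Pr \<eta> v2 (dist x y) z} = ennreal (relay_outage \<eta> Pr v2 \<tau> y x)"
  \<comment> \<open>At distance 0 the denominator \<open>0 powr \<eta> * v2\<close> is 0, and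
    division by zero makes the SNR 0, so no outage occurs there.\<close>
  proof (cases "x = y")
    case True
    then show ?thesis using pos by (simp add: snr_relay_def relay_outage_def)
  next
    case False
    then show ?thesis using snr_relay_outage[OF pos, of "dist x y"] by (simp add: relay_outage_def dist_norm)
  qed
  moreover have "{z. \<tau> < snr_relay Pr \<eta> v2 (dist x y) z} \<in> sets cgauss"
  proof -
    have "{z \<in> space borel. \<tau> < snr_relay Pr \<eta> v2 (dist x y) z} \<in> sets borel" by measurable
    then show ?thesis by simp
  qed
  ultimately show ?thesis
    using emeasure_compl_event[of "\<lambda>z. \<tau> < snr_relay Pr \<eta> v2 (dist x y) z"] relay_outage_bounds[of \<tau> Pr v2 \<eta> y x] assms
    by simp
qed

lemma integral_orthogonal_transformation:
  fixes f :: "'a::euclidean_space \<Rightarrow> real" and T :: "'a \<Rightarrow> 'a"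
  assumes T: "orthogonal_transformation T" and [measurable]: "f \<in> borel_measurable borel"
  shows "(\<integral>x. f (T x) \<partial>lborel) = (\<integral>x. f x \<partial>lborel)"
proof -
  have lin: "linear T" using T by (rule orthogonal_transformation_linear)
  then have [measurable]: "T \<in> borel_measurable borel"
    by (simp add: borel_measurable_continuous_onI linear_continuous_on linear_linear)
  have "distr lborel borel T = (lborel :: 'a measure)"
    using T lin by (intro lborel_distr_linear_isometry)
      (auto simp: orthogonal_transformation_norm orthogonal_transformation_surj)
  then have "(\<integral>x. f x \<partial>lborel) = (\<integral>x. f x \<partial>distr lborel borel T)" by simp
  then show ?thesis by (simp add: integral_distr)
qed

text \<open>Polar coordinates with the angle measured from the direction of the relay require the
  relay on the first axis. A rotation puts it there; the reflection symmetry needed by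
  \<open>polar_symmetric\<close> then holds, and the law of cosines produces
  \<open>psi\<close>.\<close>

lemma integral_outage:
  fixes relay :: "real ^ 2"
  assumes N: "2 \<le> N" and pos: "0 < \<beta>" "\<beta> \<le> 1" "0 < \<tau>" "0 < \<eta>" "0 < Ps" "0 < v1" "0 < Pr" "0 < v2"
    and relay: "norm relay = dsr"
  shows "integrable lborel (outage N \<beta> \<eta> Ps Pr v1 v2 \<tau> relay)"
    and "(\<integral>x. outage N \<beta> \<eta> Ps Pr v1 v2 \<tau> relay x \<partial>lborel) =
      2 * (J1 N \<beta> \<eta> Ps v1 \<tau> + J2 \<eta> Pr dsr v2 \<tau> - J3 N \<beta> \<eta> Ps Pr dsr v1 v2 \<tau>)"
proof -
  define F where "F = an_factor N \<beta> \<tau>"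
  define a where "a = \<tau> * v1 / (\<beta> * Ps)"
  define b where "b = \<tau> * v2 / Pr"
  have ab: "0 < a" "0 < b" using pos by (auto simp: a_def b_def)
  define es where "es x = exp (- (a * norm x powr \<eta>))" for x :: "real ^ 2"
  define er where "er y x = exp (- (b * norm (x - y) powr \<eta>))" for y x :: "real ^ 2"
  have [measurable]: "es \<in> borel_measurable borel" "er y \<in> borel_measurable borel" for y
    unfolding es_def er_def by measurable
  have es: "integrable lborel es"
    unfolding es_def using integrable_exp_norm_powr[of a \<eta> "0 :: real ^ 2"] ab pos by simp
  have er: "integrable lborel (er y)" for y
    unfolding er_def using ab pos by (intro integrable_exp_norm_powr) auto
  \<comment> \<open>The factor \<open>er y\<close> is at most 1, so \<open>es\<close> dominates the
    product.\<close>
  have es_er: "integrable lborel (\<lambda>x. es x * er y x)" for y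
    using ab by (intro Bochner_Integration.integrable_bound[OF es])
      (auto simp: es_def er_def abs_mult mult_left_le)
  let ?p = "\<lambda>x. F * es x + er relay x - F * (es x * er relay x)"
  have p: "integrable lborel ?p" using es er es_er by simp
  \<comment> \<open>Off these two null points \<open>outage\<close> is the smooth expression
    \<open>?p\<close>, without case distinctions.\<close>
  have "AE x in lborel. x \<noteq> 0 \<and> x \<noteq> relay"
    using AE_lborel_singleton[of "0 :: real ^ 2"] AE_lborel_singleton[of relay] by eventually_elim simp
  then have ae: "AE x in lborel. ?p x = outage N \<beta> \<eta> Ps Pr v1 v2 \<tau> relay x"
    by eventually_elim
      (simp add: outage_def source_outage_def relay_outage_def es_def er_def a_def b_def F_def algebra_simps)
  have [measurable]: "outage N \<beta> \<eta> Ps Pr v1 v2 \<tau> relay \<in> borel_measurable borel"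
    unfolding outage_def source_outage_def relay_outage_def by measurable
  show "integrable lborel (outage N \<beta> \<eta> Ps Pr v1 v2 \<tau> relay)"
    by (rule integrable_cong_AE_imp[OF p]) (use ae in \<open>auto elim!: eventually_mono\<close>)
  have "(\<integral>x. outage N \<beta> \<eta> Ps Pr v1 v2 \<tau> relay x \<partial>lborel) = (\<integral>x. ?p x \<partial>lborel)"
    by (rule integral_cong_AE) (use ae in \<open>auto elim!: eventually_mono\<close>)
  also have "\<dots> = F * (\<integral>x. es x \<partial>lborel) + (\<integral>x. er relay x \<partial>lborel) - F * (\<integral>x. es x * er relay x \<partial>lborel)"
    using es er es_er by simp
  also have "F * (\<integral>x. es x \<partial>lborel) = 2 * J1 N \<beta> \<eta> Ps v1 \<tau>"
  proof -
    have "(\<integral>x. es x \<partial>lborel) = 2 * pi / \<eta> * a powr (- (2 / \<eta>)) * Gamma (2 / \<eta>)"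
      unfolding es_def using ab pos by (intro integral_exp_norm_powr) auto
    also have "a powr (- (2 / \<eta>)) = (\<beta> * Ps / (\<tau> * v1)) powr (2 / \<eta>)"
    proof -
      have "\<beta> * Ps / (\<tau> * v1) = 1 / a" using pos by (simp add: a_def)
      moreover have "(1 / a) powr (2 / \<eta>) = 1 / a powr (2 / \<eta>)" using ab by (simp add: powr_divide)
      ultimately show ?thesis by (simp only: powr_minus_divide)
    qed
    finally show ?thesis by (simp add: J1_def F_def)
  qed
  finally have split: "(\<integral>x. outage N \<beta> \<eta> Ps Pr v1 v2 \<tau> relay x \<partial>lborel) =
      2 * J1 N \<beta> \<eta> Ps v1 \<tau> + (\<integral>x. er relay x \<partial>lborel) - F * (\<integral>x. es x * er relay x \<partial>lborel)" .
  have "(\<integral>x. er relay x \<partial>lborel) = 2 * J2 \<eta> Pr dsr v2 \<tau>"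
    and "F * (\<integral>x. es x * er relay x \<partial>lborel) = 2 * J3 N \<beta> \<eta> Ps Pr dsr v1 v2 \<tau>"
  proof -
    \<comment> \<open>The point on the nonnegative first axis as far from the source as the relay;
      equal norms supply the orthogonal map \<open>T\<close> taking it to the relay.\<close>
    let ?y = "vec2 dsr 0"
    have dsr: "0 \<le> dsr" using relay by auto
    have "norm ?y = norm relay"
      by (rule power2_eq_imp_eq) (use dsr relay in \<open>auto simp: norm_real2_power2\<close>)
    then obtain T where T: "orthogonal_transformation T" "T ?y = relay"
      using orthogonal_transformation_exists by blast
    have T_es: "es (T x) = es x" for x
      using T by (simp add: es_def orthogonal_transformation_norm)
    have T_er: "er relay (T x) = er ?y x" for x
    proof -
      have "T x - relay = T (x - ?y)"
        using T orthogonal_transformation_linear[OF T(1)] by (simp add: linear_diff)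
      then show ?thesis using T by (simp add: er_def orthogonal_transformation_norm)
    qed
    \<comment> \<open>Stated for any centre on the axis: \<open>c = 0\<close> is the source and
      \<open>c = dsr\<close> the rotated relay.\<close>
    have refl_norm: "norm (vec2 (x $ 1) (- x $ 2) - vec2 c 0) = norm (x - vec2 c 0)" for x :: "real ^ 2" and c
      by (rule power2_eq_imp_eq) (auto simp: norm_real2_power2)
    have refl_es: "es (vec2 (x $ 1) (- x $ 2)) = es x" for x
      using refl_norm[of x 0] by (simp add: es_def vec_eq_iff forall_2 norm_vec_def L2_set_def sum_2)
    have refl_er: "er ?y (vec2 (x $ 1) (- x $ 2)) = er ?y x" for x
      by (simp add: er_def refl_norm)
    \<comment> \<open>The identity is used as a rewrite rule under the integral and must hold for
      all \<open>r\<close>, hence the absolute value; it disappears later, where only positive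
      \<open>r\<close> matter.\<close>
    have polar_es: "es (vec2 (r * cos \<theta>) (r * sin \<theta>)) = exp (- (a * \<bar>r\<bar> powr \<eta>))" for r \<theta>
    proof -
      have "(norm (vec2 (r * cos \<theta>) (r * sin \<theta>)))\<^sup>2 = r\<^sup>2 * ((cos \<theta>)\<^sup>2 + (sin \<theta>)\<^sup>2)"
        by (simp only: norm_real2_power2 vector_2 power_mult_distrib distrib_left)
      then have "sqrt ((norm (vec2 (r * cos \<theta>) (r * sin \<theta>)))\<^sup>2) = sqrt (r\<^sup>2)" by simp
      then have "norm (vec2 (r * cos \<theta>) (r * sin \<theta>)) = \<bar>r\<bar>" by simp
      then show ?thesis by (simp add: es_def)
    qed
    have polar_er: "er ?y (vec2 (r * cos \<theta>) (r * sin \<theta>)) = exp (- psi \<eta> Pr dsr v2 \<tau> r \<theta>)" for r \<theta>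
    proof -
      let ?n = "norm (vec2 (r * cos \<theta>) (r * sin \<theta>) - ?y)"
      have "?n\<^sup>2 = dsr\<^sup>2 + r\<^sup>2 * ((cos \<theta>)\<^sup>2 + (sin \<theta>)\<^sup>2) - 2 * dsr * r * cos \<theta>"
        by (simp only: norm_real2_power2 vector_2 vector_minus_component) algebra
      then have "?n\<^sup>2 = dsr\<^sup>2 + r\<^sup>2 - 2 * dsr * r * cos \<theta>" by simp
      moreover have "?n powr \<eta> = (?n powr 2) powr (\<eta> / 2)" by (simp only: powr_powr) simp
      ultimately show ?thesis by (simp add: er_def psi_def b_def)
    qed
    have "(\<integral>x. er relay x \<partial>lborel) = (\<integral>x. er ?y x \<partial>lborel)"
      using integral_orthogonal_transformation[OF T(1), of "er relay"] by (simp add: T_er)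
    then show "(\<integral>x. er relay x \<partial>lborel) = 2 * J2 \<eta> Pr dsr v2 \<tau>"
      using polar_symmetric[OF er, of ?y] by (simp only: refl_er polar_er J2_def)
    have "(\<integral>x. es x * er relay x \<partial>lborel) = (\<integral>x. es x * er ?y x \<partial>lborel)"
      using integral_orthogonal_transformation[OF T(1), of "\<lambda>x. es x * er relay x"] by (simp add: T_er T_es)
    also have "\<dots> = 2 * (LBINT r=0..\<infinity>. (LBINT \<theta>=0..ereal pi.
        r * (exp (- (a * \<bar>r\<bar> powr \<eta>)) * exp (- psi \<eta> Pr dsr v2 \<tau> r \<theta>))))"
      using polar_symmetric[OF es_er, of ?y] by (simp only: refl_er refl_es polar_er polar_es)
    also have "(LBINT r=0..\<infinity>. (LBINT \<theta>=0..ereal pi.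
        r * (exp (- (a * \<bar>r\<bar> powr \<eta>)) * exp (- psi \<eta> Pr dsr v2 \<tau> r \<theta>)))) =
      (LBINT r=0..\<infinity>. (LBINT \<theta>=0..ereal pi.
        r * exp (- (a * r powr \<eta>)) * exp (- psi \<eta> Pr dsr v2 \<tau> r \<theta>)))"
      by (intro interval_integral_cong) (auto simp: einterval_def mult.assoc)
    finally show "F * (\<integral>x. es x * er relay x \<partial>lborel) = 2 * J3 N \<beta> \<eta> Ps Pr dsr v1 v2 \<tau>"
      by (simp add: J3_def F_def a_def)
  qed
  with split show "(\<integral>x. outage N \<beta> \<eta> Ps Pr v1 v2 \<tau> relay x \<partial>lborel) =
      2 * (J1 N \<beta> \<eta> Ps v1 \<tau> + J2 \<eta> Pr dsr v2 \<tau> - J3 N \<beta> \<eta> Ps Pr dsr v1 v2 \<tau>)"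
    by simp
qed

section \<open>The secrecy outage probability\<close>

text \<open>With the locations \<open>x i\<close> frozen, the only link between eavesdroppers is the
  beamforming through the \<open>SR\<close> coefficients. For each value of these the beam matrix is
  unitary, so the no-outage probability of an eavesdropper is the same, as
  \<open>nn_integral_indep_common_factor\<close> demands.\<close>

lemma (in prob_space) nn_integral_no_outage:
  fixes C :: "'n::finite channel \<Rightarrow> 'a \<Rightarrow> complex" and x :: "nat \<Rightarrow> real ^ 2"
    and wS :: "complex ^ 'n \<Rightarrow> complex ^ 'n" and WAN :: "complex ^ 'n \<Rightarrow> complex ^ 'm ^ 'n"
  assumes N: "2 \<le> N" "CARD('n) = N" "CARD('m) = N - 1"
    and pos: "0 < \<beta>" "\<beta> \<le> 1" "0 < Ps" "0 < v1" "0 < \<tau>" "0 < Pr" "0 < v2"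
    and indep: "indep_vars (\<lambda>_. borel) C UNIV" and C: "\<And>c. distr M borel (C c) = cgauss"
    and [measurable]: "wS \<in> borel_measurable borel" "WAN \<in> borel_measurable borel"
    and unitary: "\<And>h. unitary_matrix (beam_matrix (wS h) (WAN h))"
  shows "(\<integral>\<^sup>+\<omega>. (\<Prod>i<m.
      indicator {h. \<not> \<tau> < snr_source \<beta> Ps \<eta> v1 (wS (\<chi> k. C (SR k) \<omega>)) (WAN (\<chi> k. C (SR k) \<omega>)) (norm (x i)) h}
        (\<chi> k. C (SE i k) \<omega>) *
      indicator {z. \<not> \<tau> < snr_relay Pr \<eta> v2 (dist (x i) relay) z} (C (RE i) \<omega>)) \<partial>M) =
    (\<Prod>i<m. ennreal (1 - outage N \<beta> \<eta> Ps Pr v1 v2 \<tau> relay (x i)))"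
proof -
  \<comment> \<open>Disjoint blocks of coefficients are independent: one block is shared by all
    eavesdroppers, and each eavesdropper owns one.\<close>
  define G :: "nat option \<Rightarrow> 'n channel set"
    where "G j = (case j of None \<Rightarrow> range SR | Some i \<Rightarrow> insert (RE i) (range (SE i)))" for j
  have G_simps: "G None = range SR" "\<And>i. G (Some i) = insert (RE i) (range (SE i))" by (auto simp: G_def)
  let ?N = "\<lambda>j. Pi\<^sub>M (G j) (\<lambda>_. borel :: complex measure)"
  let ?Y = "\<lambda>j \<omega>. restrict (\<lambda>c. C c \<omega>) (G j)"
  have "disjoint_family_on G UNIV"
    by (auto simp: disjoint_family_on_def G_def split: option.splits)
  then have Y: "indep_vars ?N ?Y UNIV" using indep by (intro indep_vars_restrict) auto
  have vec: "(\<lambda>y. \<chi> k. y (f k)) \<in> borel_measurable (Pi\<^sub>M J (\<lambda>_. borel :: complex measure))"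
    if "range f \<subseteq> J" for J and f :: "'n \<Rightarrow> 'n channel"
    using that by (intro measurable_compose[OF _ measurable_vec_lambda] measurable_PiM_single' measurable_component_singleton) auto
  have [measurable]: "(\<lambda>y. \<chi> k. y (SR k)) \<in> borel_measurable (?N None)"
    "(\<lambda>y. \<chi> k. y (SE i k)) \<in> borel_measurable (?N (Some i))"
    "(\<lambda>y. y (RE i)) \<in> borel_measurable (?N (Some i))" for i
    by (auto intro!: vec measurable_component_singleton simp: G_simps)
  define A where "A v i = {h. \<not> \<tau> < snr_source \<beta> Ps \<eta> v1 (wS v) (WAN v) (norm (x i)) h}" for v i
  define B where "B i = {z. \<not> \<tau> < snr_relay Pr \<eta> v2 (dist (x i) relay) z}" for i
  have A_meas: "A v i \<in> sets borel" for v i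
  proof -
    have "{h \<in> space borel. \<not> \<tau> < snr_source \<beta> Ps \<eta> v1 (wS v) (WAN v) (norm (x i)) h} \<in> sets borel" by measurable
    then show ?thesis by (simp add: A_def)
  qed
  have B_meas: "B i \<in> sets borel" for i
  proof -
    have "{z \<in> space borel. \<not> \<tau> < snr_relay Pr \<eta> v2 (dist (x i) relay) z} \<in> sets borel" by measurable
    then show ?thesis by (simp add: B_def)
  qed
  define h where "h i z = (indicator (A (\<chi> k. fst z (SR k)) i) (\<chi> k. snd z (SE i k)) * indicator (B i) (snd z (RE i)) :: ennreal)"
    for i and z :: "('n channel \<Rightarrow> complex) \<times> ('n channel \<Rightarrow> complex)"
  have "(\<integral>\<^sup>+\<omega>. (\<Prod>i<m. h i (?Y None \<omega>, ?Y (Some i) \<omega>)) \<partial>M) =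
      (\<Prod>i<m. ennreal (1 - outage N \<beta> \<eta> Ps Pr v1 v2 \<tau> relay (x i)))"
  proof (rule nn_integral_indep_common_factor[OF Y])
    show "h i \<in> borel_measurable (?N None \<Otimes>\<^sub>M ?N (Some i))" for i
    proof -
      \<comment> \<open>The set \<open>A\<close> varies with the shared coefficients, so
        measurability is needed jointly in both components; the explicit condition on the SNRs
        provides it.\<close>
      have "h i = (\<lambda>z. if \<not> \<tau> < snr_source \<beta> Ps \<eta> v1 (wS (\<chi> k. fst z (SR k))) (WAN (\<chi> k. fst z (SR k))) (norm (x i)) (\<chi> k. snd z (SE i k)) \<and>
          \<not> \<tau> < snr_relay Pr \<eta> v2 (dist (x i) relay) (snd z (RE i)) then 1 else 0)"
        by (auto simp: h_def A_def B_def fun_eq_iff)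
      then show ?thesis by simp
    qed
    fix i :: nat and v :: "'n channel \<Rightarrow> complex"
    let ?v = "\<chi> k. v (SR k)"
    have "(\<integral>\<^sup>+\<omega>. h i (v, ?Y (Some i) \<omega>) \<partial>M) =
        (\<integral>\<^sup>+\<omega>. indicator (A ?v i) (\<chi> k. C (SE i k) \<omega>) * indicator (B i) (C (RE i) \<omega>) \<partial>M)"
      by (simp add: h_def G_simps)
    also have "\<dots> = emeasure cgauss_vec (A ?v i) * emeasure cgauss (B i)"
      by (rule nn_integral_indep_cgauss_vec[OF indep C _ _ A_meas B_meas]) (auto simp: inj_def)
    also have "\<dots> = ennreal (1 - source_outage N \<beta> \<eta> Ps v1 \<tau> (x i)) * ennreal (1 - relay_outage \<eta> Pr v2 \<tau> relay (x i))"
      unfolding A_def B_def using pos N unitary by (simp add: source_no_outage relay_no_outage)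
    also have "\<dots> = ennreal (1 - outage N \<beta> \<eta> Ps Pr v1 v2 \<tau> relay (x i))"
      using source_outage_bounds[of N \<beta> \<tau> Ps v1 \<eta> "x i"] relay_outage_bounds[of \<tau> Pr v2 \<eta> relay "x i"] pos N
      by (simp add: outage_def ennreal_mult'[symmetric])
    finally show "(\<integral>\<^sup>+\<omega>. h i (v, ?Y (Some i) \<omega>) \<partial>M) = \<dots>" .
  qed
  then show ?thesis by (simp add: h_def G_simps A_def B_def)
qed

theorem theorem1:
  fixes M :: "'w measure"
    and \<Phi> :: "'w \<Rightarrow> (real ^ 2) set"
    and X :: "nat \<Rightarrow> 'w \<Rightarrow> real ^ 2"
    and hsr :: "'w \<Rightarrow> complex ^ 'n"
    and hs :: "nat \<Rightarrow> 'w \<Rightarrow> complex ^ 'n"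
    and hr :: "nat \<Rightarrow> 'w \<Rightarrow> complex"
    and wS :: "complex ^ 'n \<Rightarrow> complex ^ 'n"
    and WAN :: "complex ^ 'n \<Rightarrow> complex ^ 'm ^ 'n"
    and \<gamma>s \<gamma>r :: "nat \<Rightarrow> 'w \<Rightarrow> real"
    and \<Gamma>E :: "'w \<Rightarrow> ereal"
    and relay :: "real ^ 2"
    and N :: nat
    and \<beta> lam \<eta> Ps Pr dsr v1 v2 rate \<tau> :: real
  assumes N: "2 \<le> N" "CARD('n) = N" "CARD('m) = N - 1"
    and beta: "0 < \<beta>" "\<beta> \<le> 1"
    and pos: "0 < lam" "0 < \<eta>" "0 < Ps" "0 < Pr" "0 < dsr" "0 < v1" "0 < v2"
    and rate: "0 < rate" "\<tau> = 2 powr rate - 1"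
    and relay: "dist 0 relay = dsr"
    and prob: "prob_space M"
    and ppp: "homogeneous_ppp M lam \<Phi>"
    and enum: "AE \<omega> in M. bij_betw (\<lambda>i. X i \<omega>) UNIV (\<Phi> \<omega>)"
    and gauss: "\<And>c. std_complex_gaussian M (channel_coeff hsr hs hr c)"
    and indep: "prob_space.indep_vars M (\<lambda>_. borel) (channel_coeff hsr hs hr) UNIV"
    and indep_ppp: "indep_elements M (Pi\<^sub>M UNIV (\<lambda>_. borel)) (\<lambda>\<omega> i. X i \<omega>)
                      (Pi\<^sub>M UNIV (\<lambda>_. borel)) (\<lambda>\<omega> c. channel_coeff hsr hs hr c \<omega>)"
    and beam_meas: "wS \<in> borel_measurable borel" "WAN \<in> borel_measurable borel"
    and beam: "\<And>h. beamforming h (wS h) (WAN h)"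
    and gamma_s: "\<And>i \<omega>. \<gamma>s i \<omega> =
          snr_source \<beta> Ps \<eta> v1 (wS (hsr \<omega>)) (WAN (hsr \<omega>)) (dist (X i \<omega>) 0) (hs i \<omega>)"
    and gamma_r: "\<And>i \<omega>. \<gamma>r i \<omega> = snr_relay Pr \<eta> v2 (dist (X i \<omega>) relay) (hr i \<omega>)"
    and Gamma_E: "\<And>\<omega>. \<Gamma>E \<omega> = (SUP i. ereal (max (\<gamma>s i \<omega>) (\<gamma>r i \<omega>)))"
  shows "measure M {\<omega> \<in> space M. \<Gamma>E \<omega> > ereal \<tau>} =
         1 - exp (- 2 * lam * (J1 N \<beta> \<eta> Ps v1 \<tau> + J2 \<eta> Pr dsr v2 \<tau>
                                 - J3 N \<beta> \<eta> Ps Pr dsr v1 v2 \<tau>))"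
proof -
  interpret prob_space M by (rule prob)
  let ?C = "channel_coeff hsr hs hr"
  let ?p = "outage N \<beta> \<eta> Ps Pr v1 v2 \<tau> relay"
  have \<tau>: "0 < \<tau>" using rate powr_less_mono[of 0 rate 2] by simp
  note [measurable] = beam_meas
  have C: "distr M borel (?C c) = cgauss" for c
  proof -
    have "distr M lborel (?C c) = cgauss"
      using gauss[of c] unfolding std_complex_gaussian_def cgauss_def by (simp add: distributed_def)
    then show ?thesis by (metis distr_cong sets_lborel)
  qed
  have C_meas[measurable]: "?C c \<in> borel_measurable M" for c using indep unfolding indep_vars_def by auto
  have unitary: "unitary_matrix (beam_matrix (wS h) (WAN h))" for h
    using beam[of h] by (simp add: beamforming_def)
  have X[measurable]: "X i \<in> borel_measurable M" for i
  proof -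
    have "(\<lambda>\<omega> i. X i \<omega>) \<in> measurable M (Pi\<^sub>M UNIV (\<lambda>_. borel))"
      using indep_ppp by (simp add: indep_elements_def)
    from measurable_compose[OF this measurable_component_singleton[of i]] show ?thesis by simp
  qed
  have vec_meas: "(\<lambda>\<omega>. \<chi> k. f k \<omega>) \<in> borel_measurable L" if "\<And>k. f k \<in> borel_measurable L" for L :: "'z measure" and f :: "'n \<Rightarrow> 'z \<Rightarrow> complex"
    using that by (intro measurable_compose[OF _ measurable_vec_lambda] measurable_PiM_single') auto
  have [measurable]: "hsr \<in> borel_measurable M" "hs i \<in> borel_measurable M" "hr i \<in> borel_measurable M" for i
    using vec_meas[of "\<lambda>k. ?C (SR k)" M, OF C_meas] vec_meas[of "\<lambda>k. ?C (SE i k)" M, OF C_meas] C_meas[of "RE i"]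
    by simp_all
  have [measurable]: "\<gamma>s i \<in> borel_measurable M" "\<gamma>r i \<in> borel_measurable M" for i
    unfolding gamma_s[abs_def] gamma_r[abs_def] by measurable
  define A where "A m = {\<omega> \<in> space M. \<forall>i<m. \<not> \<tau> < \<gamma>s i \<omega> \<and> \<not> \<tau> < \<gamma>r i \<omega>}" for m
  have A_meas[measurable]: "A m \<in> sets M" for m unfolding A_def by measurable
  \<comment> \<open>The indicator of \<open>A m\<close> as a function of locations and coefficients,
    the two independent elements, so that the locations can be frozen first.\<close>
  define \<psi> where "\<psi> m z = (\<Prod>i<m.
      indicator {h. \<not> \<tau> < snr_source \<beta> Ps \<eta> v1 (wS (\<chi> k. snd z (SR k))) (WAN (\<chi> k. snd z (SR k))) (norm (fst z i)) h}
        (\<chi> k. snd z (SE i k)) *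
      indicator {h. \<not> \<tau> < snr_relay Pr \<eta> v2 (dist (fst z i) relay) h} (snd z (RE i)) :: ennreal)"
    for m and z :: "(nat \<Rightarrow> real ^ 2) \<times> ('n channel \<Rightarrow> complex)"
  have \<psi>_meas: "\<psi> m \<in> borel_measurable (Pi\<^sub>M UNIV (\<lambda>_. borel) \<Otimes>\<^sub>M Pi\<^sub>M UNIV (\<lambda>_. borel))" for m
  proof -
    let ?L = "Pi\<^sub>M UNIV (\<lambda>_. borel) \<Otimes>\<^sub>M Pi\<^sub>M UNIV (\<lambda>_. borel) :: ((nat \<Rightarrow> real ^ 2) \<times> ('n channel \<Rightarrow> complex)) measure"
    have [measurable]: "(\<lambda>z. \<chi> k. snd z (SR k)) \<in> borel_measurable ?L" "(\<lambda>z. \<chi> k. snd z (SE i k)) \<in> borel_measurable ?L" for i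
      by (auto intro!: vec_meas)
    have "\<psi> m = (\<lambda>z. \<Prod>i<m.
      if \<not> \<tau> < snr_source \<beta> Ps \<eta> v1 (wS (\<chi> k. snd z (SR k))) (WAN (\<chi> k. snd z (SR k))) (norm (fst z i)) (\<chi> k. snd z (SE i k)) \<and>
        \<not> \<tau> < snr_relay Pr \<eta> v2 (dist (fst z i) relay) (snd z (RE i)) then 1 else 0)"
      unfolding \<psi>_def by (intro ext prod.cong) auto
    then show ?thesis by simp
  qed
  have prob_A: "prob (A m) = expectation (\<lambda>\<omega>. \<Prod>i<m. 1 - ?p (X i \<omega>))" for m
  proof -
    have bounds: "0 \<le> ?p x" "?p x \<le> 1" for x using outage_bounds N beta \<tau> pos by auto
    have [measurable]: "?p \<in> borel_measurable borel"
      unfolding outage_def source_outage_def relay_outage_def by measurable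
    have "emeasure M (A m) = (\<integral>\<^sup>+\<omega>. indicator (A m) \<omega> \<partial>M)" by simp
    also have "\<dots> = (\<integral>\<^sup>+\<omega>. \<psi> m (\<lambda>i. X i \<omega>, \<lambda>c. ?C c \<omega>) \<partial>M)"
    proof (intro nn_integral_cong)
      fix \<omega> assume "\<omega> \<in> space M"
      have "\<psi> m (\<lambda>i. X i \<omega>, \<lambda>c. ?C c \<omega>) = (\<Prod>i<m. if \<not> \<tau> < \<gamma>s i \<omega> \<and> \<not> \<tau> < \<gamma>r i \<omega> then 1 else 0)"
        unfolding \<psi>_def by (intro prod.cong) (auto simp: gamma_s gamma_r dist_norm)
      also have "\<dots> = indicator (A m) \<omega>"
        using \<open>\<omega> \<in> space M\<close> by (auto simp: A_def indicator_def intro!: prod.neutral)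
      finally show "indicator (A m) \<omega> = \<psi> m (\<lambda>i. X i \<omega>, \<lambda>c. ?C c \<omega>)" ..
    qed
    also have "\<dots> = (\<integral>\<^sup>+\<omega>. (\<integral>\<^sup>+\<omega>'. \<psi> m (\<lambda>i. X i \<omega>, \<lambda>c. ?C c \<omega>') \<partial>M) \<partial>M)"
      by (rule nn_integral_indep_elements[OF indep_ppp \<psi>_meas])
    also have "\<dots> = (\<integral>\<^sup>+\<omega>. (\<Prod>i<m. ennreal (1 - ?p (X i \<omega>))) \<partial>M)"
      unfolding \<psi>_def fst_conv snd_conv
      by (intro nn_integral_cong nn_integral_no_outage N beta pos \<tau> indep C beam_meas unitary)
    also have "\<dots> = (\<integral>\<^sup>+\<omega>. ennreal (\<Prod>i<m. 1 - ?p (X i \<omega>)) \<partial>M)"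
      using bounds by (simp add: prod_ennreal)
    finally have "emeasure M (A m) = \<dots>" .
    then show ?thesis
      using bounds by (subst integral_eq_nn_integral) (auto simp: measure_def prod_nonneg)
  qed
  have "norm relay = dsr" using \<open>dist 0 relay = dsr\<close> by simp
  note int = integral_outage[OF N(1) beta \<tau> pos(2,3,6,4,7) this]
  \<comment> \<open>The generating functional is applied to the outage probability as a function of
    the location.\<close>
  have lim: "(\<lambda>m. prob (A m)) \<longlonglongrightarrow> exp (- lam * (\<integral>x. ?p x \<partial>lborel))"
    unfolding prob_A using outage_bounds N beta \<tau> pos int(1) X enum ppp
    by (intro poisson_pgfl) auto
  have "decseq A" by (auto simp: A_def decseq_def)
  then have "(\<lambda>m. prob (A m)) \<longlonglongrightarrow> prob (\<Inter>m. A m)"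
    by (intro finite_Lim_measure_decseq) auto
  with lim have "prob (\<Inter>m. A m) = exp (- lam * (\<integral>x. ?p x \<partial>lborel))" by (rule LIMSEQ_unique[rotated])
  \<comment> \<open>A supremum exceeds \<open>\<tau>\<close> strictly exactly when one of its terms
    does, so no attained maximum is required.\<close>
  moreover have "{\<omega> \<in> space M. \<Gamma>E \<omega> > ereal \<tau>} = space M - (\<Inter>m. A m)"
    by (auto simp: A_def Gamma_E less_SUP_iff less_max_iff_disj)
  moreover have "(\<Inter>m. A m) \<in> sets M" by auto
  ultimately show ?thesis by (simp add: prob_compl int(2))
qed

end
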